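(* Let $X\subset\{0,1\}^{\mathbb{Z}}$ be a subshift such that $(S,X)$ is uniquely ergodic, and let $\widetilde{X}$ be the smallest hereditary subshift containing $X$. If $h_{top}(S,\widetilde{X})>0$, then the simplex $\mathcal{P}(S,\widetilde{X})$ is Poulsen.
   Context: $S$ denotes the left translation (shift) on $\{0,1\}^{\mathbb{Z}}$, and its restrictions to subshifts. A subshift $X\subset\{0,1\}^{\mathbb{Z}}$ is a (nonempty) closed set invariant under $S$. A subshift $X$ is hereditary if $x\in X$, $y\in\{0,1\}^{\mathbb{Z}}$ and $y\le x$ coordinatewise imply $y\in X$. For a subshift $X$, $\widetilde{X}=\{y\in\{0,1\}^{\mathbb{Z}} : y\le x \text{ coordinatewise for some } x\in X\}$ is the smallest hereditary subshift containing $X$. $\mathcal{P}(S,Y)$ is the set of $S$-invariant Borel probability measures on the subshift $Y$ with the weak topology (a Choquet simplex whose extreme points are the ergodic measures). $(S,X)$ is uniquely ergodic if $\mathcal{P}(S,X)$ has exactly one element. $h_{top}$ is topological entropy. A simplex is called Poulsen if it is non-trivial (has more than one point) and its set of extreme points is dense. *)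

theory Defs
  imports "HOL-Probability.Probability_Measure" "HOL-Library.Extended_Real"
begin

section \<open>Subshifts\<close>

text \<open>
  Points of $\{0,1\}^{\mathbb{Z}}$ are functions of type \<open>int \<Rightarrow> bool\<close>, with \<open>True\<close> for $1$. The
  topology of \<open>bool\<close> is discrete, that of the function type is the product topology, and \<open>\<le>\<close> on the
  function type is the coordinatewise order.
\<close>

definition shift :: "(int \<Rightarrow> bool) \<Rightarrow> (int \<Rightarrow> bool)" where
  "shift x = (\<lambda>i. x (i + 1))"

definition subshift :: "(int \<Rightarrow> bool) set \<Rightarrow> bool" where
  "subshift X \<longleftrightarrow> X \<noteq> {} \<and> closed X \<and> shift ` X = X"

definition hereditary :: "(int \<Rightarrow> bool) set \<Rightarrow> bool" where
  "hereditary X \<longleftrightarrow> (\<forall>x\<in>X. \<forall>y. y \<le> x \<longrightarrow> y \<in> X)"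

definition hereditary_closure :: "(int \<Rightarrow> bool) set \<Rightarrow> (int \<Rightarrow> bool) set" where
  "hereditary_closure X = {y. \<exists>x\<in>X. y \<le> x}"

lemma hereditary_hereditary_closure: "hereditary (hereditary_closure X)"
  unfolding hereditary_def hereditary_closure_def using order_trans by blast

lemma subset_hereditary_closure: "X \<subseteq> hereditary_closure X"
  unfolding hereditary_closure_def by auto

lemma hereditary_closure_least: "X \<subseteq> Y \<Longrightarrow> hereditary Y \<Longrightarrow> hereditary_closure X \<subseteq> Y"
  unfolding hereditary_def hereditary_closure_def by blast

lemma compact_UNIV_configurations: "compact (UNIV :: (int \<Rightarrow> bool) set)"
proof -
  have "compact_space (product_topology (\<lambda>i::int. euclidean :: bool topology) UNIV)"
    unfolding compact_space_product_topology
    by (simp add: compact_space_def finite_imp_compact)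
  then show ?thesis
    by (simp add: compact_space_def euclidean_product_topology)
qed

lemma compact_imp_closed_configurations:
  fixes K :: "(int \<Rightarrow> bool) set"
  assumes "compact K"
  shows "closed K"
proof -
  have "Hausdorff_space (euclidean :: bool topology)"
    unfolding Hausdorff_space_def
  proof (intro allI impI)
    fix a b :: bool
    assume "a \<in> topspace euclidean \<and> b \<in> topspace euclidean \<and> a \<noteq> b"
    then have "openin euclidean {a} \<and> openin euclidean {b} \<and> a \<in> {a} \<and> b \<in> {b} \<and> disjnt {a} {b}"
      by (simp add: open_discrete)
    then show "\<exists>U V. openin euclidean U \<and> openin euclidean V \<and> a \<in> U \<and> b \<in> V \<and> disjnt U V"
      by blast
  qed
  then have "Hausdorff_space (product_topology (\<lambda>i::int. euclidean :: bool topology) UNIV)"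
    by (simp add: Hausdorff_space_product_topology)
  then have "Hausdorff_space (euclidean :: (int \<Rightarrow> bool) topology)"
    by (simp add: euclidean_product_topology)
  then have "closedin euclidean K"
    using assms by (intro compactin_imp_closedin) simp_all
  then show ?thesis by simp
qed

lemma closed_coordinatewise_le: "closed {p :: (int \<Rightarrow> bool) \<times> (int \<Rightarrow> bool). fst p \<le> snd p}"
proof -
  have cont: "continuous_on UNIV (\<lambda>x :: int \<Rightarrow> bool. x i)" for i
    by (rule continuous_on_product_coordinates)
  have "closed {p :: (int \<Rightarrow> bool) \<times> (int \<Rightarrow> bool). fst p i \<le> snd p i}" for i
    by (rule closed_Collect_le; rule continuous_on_compose2[OF cont];
        simp add: continuous_on_fst continuous_on_snd continuous_on_id)
  moreover have "{p :: (int \<Rightarrow> bool) \<times> (int \<Rightarrow> bool). fst p \<le> snd p} = (\<Inter>i. {p. fst p i \<le> snd p i})"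
    by (auto simp: le_fun_def)
  ultimately show ?thesis by auto
qed

lemma subshift_hereditary_closure:
  assumes "subshift X"
  shows "subshift (hereditary_closure X)"
proof -
  have X: "X \<noteq> {}" "closed X" "shift ` X = X"
    using assms by (auto simp: subshift_def)
  have "compact ((UNIV :: (int \<Rightarrow> bool) set) \<times> X)"
    using X(2) compact_UNIV_configurations compact_Int_closed[of UNIV X]
    by (auto intro: compact_Times)
  then have "compact (((UNIV :: (int \<Rightarrow> bool) set) \<times> X) \<inter> {p. fst p \<le> snd p})"
    using closed_coordinatewise_le by (rule compact_Int_closed)
  then have "compact (fst ` (((UNIV :: (int \<Rightarrow> bool) set) \<times> X) \<inter> {p. fst p \<le> snd p}))"
    by (intro compact_continuous_image continuous_intros)
  moreover have "fst ` (((UNIV :: (int \<Rightarrow> bool) set) \<times> X) \<inter> {p. fst p \<le> snd p}) = hereditary_closure X"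
    unfolding hereditary_closure_def by (intro set_eqI) (simp add: image_iff Bex_def)
  ultimately have cl: "compact (hereditary_closure X)" by simp
  have fwd: "shift y \<in> hereditary_closure X" if y: "y \<in> hereditary_closure X" for y
  proof -
    obtain x where x: "x \<in> X" "y \<le> x" using y unfolding hereditary_closure_def by blast
    have "shift y \<le> shift x" using x(2) by (simp add: le_fun_def shift_def)
    moreover have "shift x \<in> X" using imageI[OF x(1), of shift] X(3) by simp
    ultimately show ?thesis unfolding hereditary_closure_def by blast
  qed
  have bwd: "y \<in> shift ` hereditary_closure X" if y: "y \<in> hereditary_closure X" for y
  proof -
    obtain z where z: "z \<in> X" "y \<le> z" using y unfolding hereditary_closure_def by blast
    from z(1) have "z \<in> shift ` X" by (simp only: X(3))
    then obtain x where "x \<in> X" "z = shift x" by (rule imageE)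
    with z(2) have x: "x \<in> X" "y \<le> shift x" by simp_all
    have "(\<lambda>i. y (i - 1)) \<le> x"
      unfolding le_fun_def
    proof
      fix i
      show "y (i - 1) \<le> x i" using le_funD[OF x(2), of "i - 1"] by (simp add: shift_def)
    qed
    then have "(\<lambda>i. y (i - 1)) \<in> hereditary_closure X"
      using x(1) unfolding hereditary_closure_def by blast
    then have "shift (\<lambda>i. y (i - 1)) \<in> shift ` hereditary_closure X" by (rule imageI)
    then show ?thesis by (simp add: shift_def)
  qed
  have "shift ` hereditary_closure X = hereditary_closure X"
  proof (rule subset_antisym)
    show "shift ` hereditary_closure X \<subseteq> hereditary_closure X" by (rule image_subsetI) (rule fwd)
    show "hereditary_closure X \<subseteq> shift ` hereditary_closure X" by (rule subsetI) (rule bwd)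
  qed
  moreover have "hereditary_closure X \<noteq> {}"
    using X(1) subset_hereditary_closure[of X] by blast
  ultimately show ?thesis
    unfolding subshift_def using compact_imp_closed_configurations[OF cl] by simp
qed


section \<open>Invariant measures\<close>

text \<open>
  Measures on \<open>X\<close> have \<open>X\<close> as their space and the Borel sets of the subspace \<open>X\<close> as their
  \<open>\<sigma>\<close>-algebra. Distinct elements of the type \<open>'a measure\<close> with the same measurable sets differ
  on a measurable set, so equality of elements of \<open>invariant_measures T X\<close> is equality of measures.
\<close>

definition invariant_measures ::
    "('a::topological_space \<Rightarrow> 'a) \<Rightarrow> 'a set \<Rightarrow> 'a measure set" where
  "invariant_measures T X = {\<mu>. prob_space \<mu> \<and> sets \<mu> = sets (restrict_space borel X) \<and>
     T \<in> \<mu> \<rightarrow>\<^sub>M \<mu> \<and> distr \<mu> \<mu> T = \<mu>}"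

definition uniquely_ergodic :: "('a::topological_space \<Rightarrow> 'a) \<Rightarrow> 'a set \<Rightarrow> bool" where
  "uniquely_ergodic T X \<longleftrightarrow> (\<exists>!\<mu>. \<mu> \<in> invariant_measures T X)"

text \<open>
  For compact \<open>X\<close> this is the weak topology: the coarsest one for which \<open>\<mu> \<mapsto> \<integral> f d\<mu>\<close> is continuous
  for every continuous \<open>f\<close> on \<open>X\<close>.
\<close>

definition weak_topology ::
    "('a::topological_space \<Rightarrow> 'a) \<Rightarrow> 'a set \<Rightarrow> 'a measure topology" where
  "weak_topology T X = topology_generated_by
     {{\<mu> \<in> invariant_measures T X. (\<integral>x. f x \<partial>\<mu>) \<in> U} | (f :: 'a \<Rightarrow> real) U.
        continuous_on X f \<and> open U}"

lemma topspace_weak_topology: "topspace (weak_topology T X) = invariant_measures T X"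
proof -
  have "invariant_measures T X = {\<mu> \<in> invariant_measures T X. (\<integral>x. 0 \<partial>\<mu>) \<in> (UNIV :: real set)}"
    by simp
  then have "invariant_measures T X \<in> {{\<mu> \<in> invariant_measures T X. (\<integral>x. f x \<partial>\<mu>) \<in> U} |
      (f :: 'a \<Rightarrow> real) U. continuous_on X f \<and> open U}"
    using continuous_on_const open_UNIV by blast
  then show ?thesis
    unfolding weak_topology_def topology_generated_by_topspace by blast
qed

text \<open>
  Extreme points for convex combinations of measures. The library's \<open>extreme_point_of\<close> needs a
  real vector space, which \<open>'a measure\<close> is not.
\<close>

definition extreme_measures :: "'a measure set \<Rightarrow> 'a measure set" where
  "extreme_measures P = {\<mu> \<in> P. \<forall>\<nu>\<^sub>1\<in>P. \<forall>\<nu>\<^sub>2\<in>P. \<forall>t::real. 0 < t \<longrightarrow> t < 1 \<longrightarrow>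
     (\<forall>A\<in>sets \<mu>. measure \<mu> A = t * measure \<nu>\<^sub>1 A + (1 - t) * measure \<nu>\<^sub>2 A) \<longrightarrow> \<nu>\<^sub>1 = \<mu> \<and> \<nu>\<^sub>2 = \<mu>}"

definition poulsen :: "'a measure topology \<Rightarrow> bool" where
  "poulsen W \<longleftrightarrow> (\<exists>\<mu>\<in>topspace W. \<exists>\<nu>\<in>topspace W. \<mu> \<noteq> \<nu>) \<and>
     W closure_of (extreme_measures (topspace W)) = topspace W"


section \<open>Topological entropy\<close>

text \<open>
  The Adler--Konheim--McAndrew definition by open covers, for a map \<open>T\<close> on a compact set \<open>X\<close>.
  \<open>cover_join T X \<U> n\<close> is the join of the preimages of \<open>\<U>\<close> under \<open>T ^^ i\<close> for \<open>i < n\<close>.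
\<close>

definition open_covers :: "'a::topological_space set \<Rightarrow> 'a set set set" where
  "open_covers X = {\<U>. (\<forall>U\<in>\<U>. openin (top_of_set X) U) \<and> \<Union>\<U> = X}"

definition cover_join :: "('a \<Rightarrow> 'a) \<Rightarrow> 'a set \<Rightarrow> 'a set set \<Rightarrow> nat \<Rightarrow> 'a set set" where
  "cover_join T X \<U> n = {{x \<in> X. \<forall>i<n. (T ^^ i) x \<in> V i} | V. \<forall>i<n. V i \<in> \<U>}"

definition min_subcover_card :: "'a set \<Rightarrow> 'a set set \<Rightarrow> nat" where
  "min_subcover_card X \<U> = Inf {card \<V> | \<V>. finite \<V> \<and> \<V> \<subseteq> \<U> \<and> X \<subseteq> \<Union>\<V>}"

text \<open>The \<open>limsup\<close> is a limit, by subadditivity.\<close>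

definition cover_entropy :: "('a \<Rightarrow> 'a) \<Rightarrow> 'a set \<Rightarrow> 'a set set \<Rightarrow> ereal" where
  "cover_entropy T X \<U> =
     limsup (\<lambda>n. ereal (ln (real (min_subcover_card X (cover_join T X \<U> n))) / real n))"

definition topological_entropy :: "('a::topological_space \<Rightarrow> 'a) \<Rightarrow> 'a set \<Rightarrow> ereal" where
  "topological_entropy T X = (SUP \<U>\<in>open_covers X. cover_entropy T X \<U>)"

end

theory Submission
  imports Defs "HOL-Probability.Product_PMF"
begin

text \<open>
  Let \<open>\<nu>\<close> be the invariant measure of \<open>X\<close> and let \<open>Y\<close> be the hereditary closure of \<open>X\<close>.

  \<^bold>\<open>Density.\<close> The weak topology on the invariant measures of \<open>Y\<close> only sees the laws of finite windows
  (\<open>weak_closure_eqI\<close>). So, given an invariant measure \<open>\<mu>\<close> of \<open>Y\<close> and a window, an extreme measure is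
  needed whose law on the window is almost that of \<open>\<mu>\<close>. It is the law of the following process.
  Draw \<open>x\<close> from \<open>\<nu>\<close>, and independently of \<open>x\<close> cut the integers at each coordinate with a small
  probability \<open>q\<close>. To each cut belongs an independent random choice of a block below the block of \<open>x\<close>
  that begins there; from each cut up to the next one, replace \<open>x\<close> by this block. The result lies
  below \<open>x\<close>, hence in \<open>Y\<close>. As the window rarely meets a cut, it lies within one such block in all but few
  cases, so it is enough that the random block has almost the law of a block of \<open>\<mu>\<close>.

  Such a random choice exists (\<open>block_kernel\<close>): a \<open>\<mu>\<close>-random point \<open>y\<close> lies below some \<open>x \<in> X\<close>, and
  reading a block of this pair at a uniformly random place in a long interval gives a block \<open>v\<close>
  with the law that \<open>\<mu>\<close> prescribes, below a block \<open>w\<close> of \<open>x\<close> whose law is almost that of \<open>\<nu>\<close>, because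
  in all points of \<open>X\<close> the words have the same frequencies. Choose \<open>v\<close> conditionally on \<open>w\<close>.

  The process is extreme because frequencies converge to constants in mean square. It is obtained from
  \<open>x\<close> and independent marks by a code of finite range; conditionally on \<open>x\<close>, distant coordinates are
  independent, so an empirical frequency concentrates at its conditional mean
  (\<open>iid_average_variance\<close>), which is an average of a function of finitely many coordinates along the orbit of
  \<open>x\<close>, and such averages converge uniformly on \<open>X\<close> (\<open>uniform_average\<close>). If a
  measure with this property is a proper convex combination of two invariant ones, each of them is dominated by a
  multiple of it, so frequencies have the same limits for each of them, and all three measures agree on
  cylinders (\<open>extreme_measureI\<close>).

  \<^bold>\<open>Non-triviality.\<close> If \<open>\<nu>\<close> gives positive mass to \<open>x 0\<close>, then \<open>\<nu>\<close> and the point mass at the zero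
  configuration are two invariant measures of \<open>Y\<close>. Otherwise ones have frequency zero, uniformly in \<open>X\<close>
  and hence in \<open>Y\<close>. The number of words with few ones grows subexponentially, so the entropy of \<open>Y\<close>
  vanishes (\<open>zero_density_imp_zero_entropy\<close>).
\<close>

section \<open>Cylinder sets\<close>

text \<open>
  Sets depending on the coordinates in \<open>J\<close> are written \<open>trunc J -` B\<close>. Words on \<open>J\<close> are thereby
  configurations vanishing off \<open>J\<close>, so a word read off a point of a hereditary subshift is
  itself a point of this subshift.
\<close>

definition trunc :: "int set \<Rightarrow> (int \<Rightarrow> bool) \<Rightarrow> (int \<Rightarrow> bool)" where
  "trunc J x = (\<lambda>i. i \<in> J \<and> x i)"

definition window :: "nat \<Rightarrow> int set" where
  "window n = {- int n..int n}"

lemma finite_window [simp]: "finite (window n)"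
  by (simp add: window_def)

lemma window_mono: "m \<le> n \<Longrightarrow> window m \<subseteq> window n"
  by (auto simp: window_def)

lemma trunc_eq_iff: "trunc J x = trunc J y \<longleftrightarrow> (\<forall>i\<in>J. x i = y i)"
  by (auto simp: trunc_def fun_eq_iff)

lemma trunc_trunc: "trunc J (trunc K x) = trunc (J \<inter> K) x"
  by (auto simp: trunc_def fun_eq_iff)

lemma trunc_le: "trunc J x \<le> x"
  by (simp add: trunc_def le_fun_def)

lemma trunc_mono: "x \<le> y \<Longrightarrow> trunc J x \<le> trunc J y"
  by (auto simp: trunc_def le_fun_def)

lemma finite_range_trunc:
  assumes "finite J" shows "finite (range (trunc J))"
proof (rule finite_subset)
  show "range (trunc J) \<subseteq> (\<lambda>A i. i \<in> A) ` Pow J"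
  proof
    fix z assume "z \<in> range (trunc J)"
    then obtain x where "z = trunc J x" by blast
    then have "z = (\<lambda>i. i \<in> {i \<in> J. x i})" by (simp add: trunc_def)
    then show "z \<in> (\<lambda>A i. i \<in> A) ` Pow J" by blast
  qed
  show "finite ((\<lambda>A i. i \<in> A) ` Pow J)" using assms by simp
qed

lemma finite_subset_window:
  assumes "finite J" obtains n where "J \<subseteq> window n"
proof -
  obtain n where "\<forall>i\<in>J. nat \<bar>i\<bar> \<le> n"
    using assms finite_nat_set_iff_bounded_le[of "(\<lambda>i. nat \<bar>i\<bar>) ` J"] by auto
  then have "i \<in> window n" if "i \<in> J" for i
    using that by (force simp: window_def nat_le_iff)
  then have "J \<subseteq> window n" by blast
  then show ?thesis using that by blast
qed

lemma open_coordinate: "open {x :: int \<Rightarrow> bool. x i = b}"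
proof -
  have "continuous_on UNIV (\<lambda>x :: int \<Rightarrow> bool. x i)"
    by (rule continuous_on_product_coordinates)
  then have "open ((\<lambda>x :: int \<Rightarrow> bool. x i) -` {b})"
    by (rule open_vimage[rotated]) (simp add: open_discrete)
  then show ?thesis by (simp add: vimage_def)
qed

lemma open_trunc_vimage:
  assumes "finite J" shows "open (trunc J -` B)"
proof -
  have "open (trunc J -` {trunc J x})" for x
  proof -
    have "trunc J -` {trunc J x} = (\<Inter>i\<in>J. {y. y i = x i})"
      by (auto simp: trunc_eq_iff)
    then show ?thesis using assms open_coordinate by (auto intro: open_INT)
  qed
  then have "open (\<Union>x\<in>trunc J -` B. trunc J -` {trunc J x})" by blast
  moreover have "(\<Union>x\<in>trunc J -` B. trunc J -` {trunc J x}) = trunc J -` B" by auto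
  ultimately show ?thesis by simp
qed

lemma closed_trunc_vimage:
  assumes "finite J" shows "closed (trunc J -` B)"
  using open_trunc_vimage[OF assms, of "- B"] by (simp add: closed_def vimage_Compl)

lemma open_contains_cylinder:
  assumes "open U" "x \<in> U"
  obtains n where "trunc (window n) -` {trunc (window n) x} \<subseteq> U"
proof -
  have "openin (product_topology (\<lambda>i::int. euclidean :: bool topology) UNIV) U"
    using assms(1) by (simp add: euclidean_product_topology)
  from product_topology_open_contains_basis[OF this assms(2)]
  obtain V where V: "x \<in> (\<Pi>\<^sub>E i\<in>UNIV. V i)" "finite {i. V i \<noteq> UNIV}" "(\<Pi>\<^sub>E i\<in>UNIV. V i) \<subseteq> U"
    by auto
  obtain n where n: "{i. V i \<noteq> UNIV} \<subseteq> window n"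
    using finite_subset_window[OF V(2)] by blast
  have "trunc (window n) -` {trunc (window n) x} \<subseteq> (\<Pi>\<^sub>E i\<in>UNIV. V i)"
  proof
    fix y assume "y \<in> trunc (window n) -` {trunc (window n) x}"
    then have y: "\<forall>i\<in>window n. y i = x i" by (simp add: trunc_eq_iff)
    have "y i \<in> V i" for i
    proof (cases "i \<in> window n")
      case True
      then have "y i = x i" using y by blast
      then show ?thesis using V(1) by auto
    next
      case False
      then have "V i = UNIV" using n by blast
      then show ?thesis by simp
    qed
    then show "y \<in> (\<Pi>\<^sub>E i\<in>UNIV. V i)" by auto
  qed
  then show ?thesis by (rule that[OF subset_trans[OF _ V(3)]])
qed

lemma open_eq_Union_cylinders:
  assumes "open U"
  shows "U = (\<Union>n. trunc (window n) -` {z. trunc (window n) -` {z} \<subseteq> U})"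
proof
  show "U \<subseteq> (\<Union>n. trunc (window n) -` {z. trunc (window n) -` {z} \<subseteq> U})"
  proof
    fix x assume "x \<in> U"
    then obtain n where "trunc (window n) -` {trunc (window n) x} \<subseteq> U"
      using open_contains_cylinder[OF assms] by blast
    then show "x \<in> (\<Union>n. trunc (window n) -` {z. trunc (window n) -` {z} \<subseteq> U})" by blast
  qed
  show "(\<Union>n. trunc (window n) -` {z. trunc (window n) -` {z} \<subseteq> U}) \<subseteq> U" by auto
qed

definition cylinders :: "(int \<Rightarrow> bool) set set" where
  "cylinders = {trunc (window n) -` B | n B. True}"

lemma vimage_trunc_in_cylinders:
  assumes "finite J" shows "trunc J -` B \<in> cylinders"
proof -
  obtain n where "J \<subseteq> window n" using finite_subset_window[OF assms] .
  then have "trunc J -` B = trunc (window n) -` (trunc J -` B)"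
    by (auto simp: trunc_trunc inf.absorb1)
  then show ?thesis unfolding cylinders_def by blast
qed

lemma cylinder_window_mono:
  "m \<le> n \<Longrightarrow> trunc (window m) -` B = trunc (window n) -` (trunc (window m) -` B)"
  using window_mono[of m n] by (auto simp: trunc_trunc inf.absorb1)

lemma algebra_cylinders: "algebra UNIV cylinders"
  unfolding algebra_iff_Un
proof (intro conjI ballI)
  show "{} \<in> cylinders" unfolding cylinders_def by (auto intro!: exI[of _ "{}"])
next
  fix a assume "a \<in> cylinders"
  then obtain n B where "a = trunc (window n) -` B" unfolding cylinders_def by blast
  then have "UNIV - a = trunc (window n) -` (- B)" by auto
  then show "UNIV - a \<in> cylinders" unfolding cylinders_def by blast
next
  fix a b assume "a \<in> cylinders" "b \<in> cylinders"
  then obtain m A n B where "a = trunc (window m) -` A" "b = trunc (window n) -` B"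
    unfolding cylinders_def by blast
  then have "a \<union> b = trunc (window (max m n)) -` (trunc (window m) -` A \<union> trunc (window n) -` B)"
    using cylinder_window_mono[of m "max m n" A] cylinder_window_mono[of n "max m n" B] by auto
  then show "a \<union> b \<in> cylinders" unfolding cylinders_def by blast
qed auto

lemma sets_borel_cylinders: "sets borel = sigma_sets UNIV cylinders"
proof -
  have "sets (borel :: (int \<Rightarrow> bool) measure) = sigma_sets UNIV {S. open S}"
    by (simp add: borel_def)
  also have "\<dots> = sigma_sets UNIV cylinders"
  proof (rule sigma_sets_eqI)
    fix U :: "(int \<Rightarrow> bool) set" assume "U \<in> {S. open S}"
    then have eq: "U = (\<Union>n. trunc (window n) -` {z. trunc (window n) -` {z} \<subseteq> U})"
      using open_eq_Union_cylinders by blast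
    show "U \<in> sigma_sets UNIV cylinders"
      by (subst eq, rule sigma_sets.Union, rule sigma_sets.Basic) (unfold cylinders_def, blast)
  next
    fix C assume "C \<in> cylinders"
    then show "C \<in> sigma_sets UNIV {S. open S}"
      by (auto simp: cylinders_def intro!: open_trunc_vimage)
  qed
  finally show ?thesis .
qed

lemma measurable_trunc [measurable]:
  assumes "finite J" shows "trunc J \<in> borel \<rightarrow>\<^sub>M count_space UNIV"
  by (rule measurableI) (auto intro!: borel_open open_trunc_vimage[OF assms])

lemma compact_closed_configurations: "closed (Y :: (int \<Rightarrow> bool) set) \<Longrightarrow> compact Y"
  using compact_Int_closed[OF compact_UNIV_configurations] by simp

text \<open>
  A Lebesgue number lemma: by compactness, a property that small neighbourhoods have
  locally holds for all cylinders over one sufficiently large window.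
\<close>

lemma uniform_window:
  fixes Y :: "(int \<Rightarrow> bool) set"
  assumes "closed Y"
    and loc: "\<And>x. x \<in> Y \<Longrightarrow> \<exists>U. open U \<and> x \<in> U \<and> P (U \<inter> Y)"
    and mono: "\<And>A B. P A \<Longrightarrow> B \<subseteq> A \<Longrightarrow> P B"
  obtains n where "\<And>x. x \<in> Y \<Longrightarrow> P (trunc (window n) -` {trunc (window n) x} \<inter> Y)"
proof -
  define V where "V n = trunc (window n) -` {z. P (trunc (window n) -` {z} \<inter> Y)}" for n
  have op: "open (V n)" for n unfolding V_def by (rule open_trunc_vimage) simp
  have cov: "Y \<subseteq> (\<Union>n. V n)"
  proof
    fix x assume x: "x \<in> Y"
    then obtain U where U: "open U" "x \<in> U" "P (U \<inter> Y)" using loc by blast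
    obtain n where n: "trunc (window n) -` {trunc (window n) x} \<subseteq> U"
      using open_contains_cylinder[OF U(1,2)] .
    have "P (trunc (window n) -` {trunc (window n) x} \<inter> Y)"
      by (rule mono[OF U(3)]) (use n in auto)
    then have "x \<in> V n" unfolding V_def by simp
    then show "x \<in> (\<Union>n. V n)" by blast
  qed
  obtain N where N: "finite N" "Y \<subseteq> (\<Union>n\<in>N. V n)"
    by (rule compactE_image[OF compact_closed_configurations[OF assms(1)] op cov])
  show ?thesis
  proof (rule that[of "Max (insert 0 N)"])
    fix x assume "x \<in> Y"
    then obtain n where n: "n \<in> N" "x \<in> V n" using N(2) by blast
    then have "n \<le> Max (insert 0 N)" using N(1) by simp
    then have "window n \<subseteq> window (Max (insert 0 N))" by (rule window_mono)
    then have sub: "trunc (window (Max (insert 0 N))) -` {trunc (window (Max (insert 0 N))) x} \<inter> Y \<subseteq>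
        trunc (window n) -` {trunc (window n) x} \<inter> Y"
      by (simp add: trunc_eq_iff subset_eq)
    have "P (trunc (window n) -` {trunc (window n) x} \<inter> Y)" using n(2) unfolding V_def by simp
    then show "P (trunc (window (Max (insert 0 N))) -` {trunc (window (Max (insert 0 N))) x} \<inter> Y)"
      using sub by (rule mono)
  qed
qed

lemma shift_funpow: "(shift ^^ n) x = (\<lambda>i. x (i + int n))"
  by (induction n arbitrary: x) (auto simp: shift_def algebra_simps)

lemma trunc_shift_funpow:
  "trunc J ((shift ^^ n) x) = trunc J ((shift ^^ n) (trunc ((\<lambda>i. i + int n) ` J) x))"
  by (auto simp: trunc_def shift_funpow fun_eq_iff)

section \<open>Uniform frequencies in uniquely ergodic subshifts\<close>

lemma sets_restrict_closed_eq_sigma_sets: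
  assumes "closed Y"
  shows "sets (restrict_space borel Y) = sigma_sets Y ((\<inter>) Y ` cylinders)"
proof -
  have "Y \<in> sigma_sets UNIV cylinders"
    using assms by (simp add: sets_borel_cylinders[symmetric])
  from sigma_sets_Int[OF this] show ?thesis
    by (simp add: sets_restrict_space sets_borel_cylinders)
qed

lemma shift_vimage_cylinder:
  assumes "C \<in> cylinders" shows "(shift ^^ n) -` C \<in> cylinders"
proof -
  obtain m B where C: "C = trunc (window m) -` B" using assms unfolding cylinders_def by blast
  have "(shift ^^ n) -` C = trunc ((\<lambda>i. i + int n) ` window m) -` ((\<lambda>x. trunc (window m) ((shift ^^ n) x)) -` B)"
    unfolding C by (auto simp: trunc_shift_funpow[symmetric])
  then show ?thesis by (simp add: vimage_trunc_in_cylinders)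
qed

lemma subshift_closed: "subshift Y \<Longrightarrow> closed Y"
  by (simp add: subshift_def)

lemma inj_shift: "inj shift"
proof (rule injI)
  fix x y assume eq: "shift x = shift y"
  have "x i = y i" for i using fun_cong[OF eq, of "i - 1"] by (simp add: shift_def)
  then show "x = y" by blast
qed

lemma subshift_shift_iff: "subshift Y \<Longrightarrow> shift x \<in> Y \<longleftrightarrow> x \<in> Y"
  unfolding subshift_def using inj_image_mem_iff[OF inj_shift] by blast

lemma subshift_funpow_iff: "subshift Y \<Longrightarrow> (shift ^^ n) x \<in> Y \<longleftrightarrow> x \<in> Y"
  by (induction n) (simp_all add: subshift_shift_iff)

lemma measurable_shift [measurable]: "shift \<in> borel \<rightarrow>\<^sub>M borel"
proof (rule borel_measurable_continuous_onI)
  show "continuous_on UNIV shift"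
    by (rule continuous_on_coordinatewise_then_product)
       (simp add: shift_def continuous_on_product_coordinates)
qed

lemma measurable_shift_restrict:
  assumes "subshift Y"
  shows "shift \<in> restrict_space borel Y \<rightarrow>\<^sub>M restrict_space borel Y"
  by (rule measurable_restrict_space3[OF measurable_shift]) (use assms subshift_shift_iff in auto)

lemma sets_borel_restrictD:
  assumes "sets \<mu> = sets (restrict_space borel Y)"
  shows "space \<mu> = Y" and "A \<in> sets borel \<Longrightarrow> A \<inter> Y \<in> sets \<mu>"
    and "finite J \<Longrightarrow> trunc J \<in> \<mu> \<rightarrow>\<^sub>M count_space UNIV"
    and "finite J \<Longrightarrow> trunc J -` B \<inter> Y \<in> sets \<mu>"
proof -
  show "space \<mu> = Y" using sets_eq_imp_space_eq[OF assms] by (simp add: space_restrict_space)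
  show *: "A \<inter> Y \<in> sets \<mu>" if "A \<in> sets borel" for A
    using that by (auto simp: assms sets_restrict_space)
  show "trunc J \<in> \<mu> \<rightarrow>\<^sub>M count_space UNIV" if "finite J"
    unfolding measurable_cong_sets[OF assms refl]
    by (rule measurable_restrict_space1[OF measurable_trunc[OF that]])
  show "trunc J -` B \<inter> Y \<in> sets \<mu>" if "finite J"
    by (rule *) (simp add: open_trunc_vimage[OF that])
qed

lemma cylinders_borel: "C \<in> cylinders \<Longrightarrow> C \<in> sets borel"
  by (simp add: sets_borel_cylinders)

lemma prob_measure_eqI_cylinders:
  assumes Y: "closed Y" and p: "prob_space \<mu>" "prob_space \<nu>"
    and s: "sets \<mu> = sets (restrict_space borel Y)" "sets \<nu> = sets (restrict_space borel Y)"
    and eq: "\<And>C. C \<in> cylinders \<Longrightarrow> measure \<mu> (C \<inter> Y) = measure \<nu> (C \<inter> Y)"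
  shows "\<mu> = \<nu>"
proof -
  interpret a: prob_space \<mu> by fact
  interpret b: prob_space \<nu> by fact
  interpret alg: algebra UNIV cylinders by (rule algebra_cylinders)
  show ?thesis
  proof (rule measure_eqI_generator_eq[where E = "(\<inter>) Y ` cylinders" and \<Omega> = Y and A = "\<lambda>_. Y"])
    show "Int_stable ((\<inter>) Y ` cylinders)"
    proof (rule Int_stableI)
      fix a b assume "a \<in> (\<inter>) Y ` cylinders" "b \<in> (\<inter>) Y ` cylinders"
      then obtain A B where "A \<in> cylinders" "B \<in> cylinders" "a = Y \<inter> A" "b = Y \<inter> B" by blast
      then have "a \<inter> b = Y \<inter> (A \<inter> B)" "A \<inter> B \<in> cylinders" by auto
      then show "a \<inter> b \<in> (\<inter>) Y ` cylinders" by blast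
    qed
    show "emeasure \<mu> S = emeasure \<nu> S" if "S \<in> (\<inter>) Y ` cylinders" for S
      using that eq by (auto simp: a.emeasure_eq_measure b.emeasure_eq_measure Int_commute)
    show "range (\<lambda>_::nat. Y) \<subseteq> (\<inter>) Y ` cylinders"
      using alg.top by blast
  qed (auto simp: s sets_restrict_closed_eq_sigma_sets[OF Y])
qed

definition frequency :: "nat \<Rightarrow> (int \<Rightarrow> bool) \<Rightarrow> (int \<Rightarrow> bool) set \<Rightarrow> real" where
  "frequency n x A = (\<Sum>i<n. indicator A ((shift ^^ i) x)) / real n"

lemma compact_unit_cube: "compact (Pi UNIV (\<lambda>_. {0..1}) :: ('a \<Rightarrow> real) set)"
proof -
  have "compactin (product_topology (\<lambda>_::'a. euclidean :: real topology) UNIV) (Pi\<^sub>E UNIV (\<lambda>_. {0..1}))"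
    by (subst compactin_PiE) auto
  then show ?thesis
    by (simp add: euclidean_product_topology PiE_UNIV_domain Pi_def)
qed

lemma frequency_bounds: "0 \<le> frequency n x A" "frequency n x A \<le> 1"
proof -
  show "0 \<le> frequency n x A" unfolding frequency_def by (simp add: sum_nonneg)
  have "(\<Sum>i<n. indicator A ((shift ^^ i) x) :: real) \<le> (\<Sum>i<n. 1)"
    by (rule sum_mono) (simp add: indicator_def)
  then show "frequency n x A \<le> 1" unfolding frequency_def by (cases "n = 0") (simp_all add: divide_le_eq)
qed

lemma frequency_shift:
  "\<bar>frequency n x (shift -` A) - frequency n x A\<bar> \<le> 1 / real n"
proof -
  let ?a = "\<lambda>i. indicator A ((shift ^^ i) x) :: real"
  have "(\<Sum>i<n. indicator (shift -` A) ((shift ^^ i) x) :: real) = (\<Sum>i<n. ?a (Suc i))"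
    by (rule sum.cong) (auto simp: indicator_def)
  then have "frequency n x (shift -` A) - frequency n x A = (\<Sum>i<n. ?a (Suc i) - ?a i) / real n"
    unfolding frequency_def by (simp add: sum_subtractf diff_divide_distrib)
  also have "(\<Sum>i<n. ?a (Suc i) - ?a i) = ?a n - ?a 0" by (rule sum_lessThan_telescope)
  finally show ?thesis by (cases "n = 0") (auto simp: indicator_def)
qed

text \<open>
  The frequencies along an orbit form a finitely additive set function, invariant up to \<open>1 / n\<close>. All
  the required properties are closed conditions on functions in the compact cube \<open>[0, 1]\<close> to the
  power of all sets of configurations, so a cluster point satisfies them exactly.
\<close>

lemma invariant_mean_of_frequencies:
  assumes X: "subshift X" and inf: "\<And>m::nat. \<exists>n\<ge>m. \<exists>x\<in>X. c \<le> frequency n x C"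
  obtains g :: "(int \<Rightarrow> bool) set \<Rightarrow> real"
  where "\<And>A. 0 \<le> g A" "g X = 1" "\<And>A B. A \<inter> B = {} \<Longrightarrow> g (A \<union> B) = g A + g B"
    "\<And>A. g (shift -` A) = g A" "c \<le> g C"
proof -
  define K where "K m = {g. (\<forall>A B. A \<inter> B = {} \<longrightarrow> g (A \<union> B) = g A + g B) \<and> g X = 1 \<and>
      (\<forall>A. \<bar>g (shift -` A) - g A\<bar> \<le> 1 / real (Suc m)) \<and> c \<le> g C}" for m
  define S :: "((int \<Rightarrow> bool) set \<Rightarrow> real) set" where "S = Pi UNIV (\<lambda>_. {0..1})"
  have freq: "frequency n x \<in> S \<inter> K m" if "n \<ge> Suc m" "x \<in> X" "c \<le> frequency n x C" for n x m
  proof -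
    have "frequency n x (A \<union> B) = frequency n x A + frequency n x B" if "A \<inter> B = {}" for A B
      unfolding frequency_def using that
      by (simp add: indicator_add[symmetric] sum.distrib add_divide_distrib)
    moreover have "frequency n x X = 1"
      unfolding frequency_def using \<open>n \<ge> Suc m\<close> \<open>x \<in> X\<close> by (simp add: subshift_funpow_iff[OF X])
    moreover have "\<bar>frequency n x (shift -` A) - frequency n x A\<bar> \<le> 1 / real (Suc m)" for A
      by (rule order_trans[OF frequency_shift]) (use \<open>n \<ge> Suc m\<close> in \<open>simp add: frac_le\<close>)
    ultimately show ?thesis
      using that(3) unfolding K_def S_def by (auto simp: frequency_bounds)
  qed
  have cont: "continuous_on UNIV (\<lambda>g :: (int \<Rightarrow> bool) set \<Rightarrow> real. g A)" for A
    by (rule continuous_on_product_coordinates)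
  have closed: "closed (K m)" for m
    unfolding K_def
    by (intro closed_Collect_conj closed_Collect_all closed_Collect_imp open_Collect_const
        closed_Collect_eq closed_Collect_le continuous_intros cont)
  \<comment> \<open>The frequencies along one sufficiently long orbit segment lie in any finitely many of the sets \<open>K m\<close>.\<close>
  have "S \<inter> (\<Inter>m\<in>UNIV. K m) \<noteq> {}"
  proof (rule compact_imp_fip_image)
    show "compact S" unfolding S_def by (rule compact_unit_cube)
    show "closed (K m)" for m by (rule closed)
    show "S \<inter> (\<Inter>m\<in>I. K m) \<noteq> {}" if I: "finite I" for I
    proof -
      \<comment> \<open>Inserting \<open>0\<close> keeps the maximum meaningful for empty \<open>I\<close>.\<close>
      obtain n x where n: "n \<ge> Suc (Max (insert 0 I))" "x \<in> X" "c \<le> frequency n x C"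
        using inf by blast
      have "frequency n x \<in> S \<inter> K m" if "m \<in> insert 0 I" for m
      proof (rule freq)
        have "m \<le> Max (insert 0 I)" using that I by (intro Max_ge) auto
        then show "Suc m \<le> n" using n(1) by simp
      qed (use n in auto)
      then show ?thesis by blast
    qed
  qed
  then obtain g where g: "g \<in> S" "\<And>m. g \<in> K m" by blast
  show ?thesis
  proof (rule that[of g])
    show "g (shift -` A) = g A" for A
    proof -
      have "\<bar>g (shift -` A) - g A\<bar> \<le> 0 + e" if e: "e > 0" for e
      proof -
        obtain m where "1 / real (Suc m) < e" by (rule nat_approx_posE[OF e])
        moreover have "\<bar>g (shift -` A) - g A\<bar> \<le> 1 / real (Suc m)" using g(2)[of m] by (simp add: K_def)
        ultimately show ?thesis by linarith
      qed
      then have "\<bar>g (shift -` A) - g A\<bar> \<le> 0" by (rule field_le_epsilon)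
      then show ?thesis by simp
    qed
  qed (use g(1) g(2)[of 0] in \<open>auto simp: S_def K_def\<close>)
qed

text \<open>
  On cylinders a finitely additive set function is automatically countably additive: cylinders are
  compact and open, so a decreasing sequence of them with empty intersection is eventually empty.
\<close>

lemma invariant_measure_of_mean:
  assumes X: "subshift X" and g: "\<And>A. 0 \<le> g A" "g X = 1"
    "\<And>A B. A \<inter> B = {} \<Longrightarrow> g (A \<union> B) = g A + g B" "\<And>A. g (shift -` A) = g A"
  shows "\<exists>\<mu>\<in>invariant_measures shift X. \<forall>C\<in>cylinders. measure \<mu> (C \<inter> X) = g (C \<inter> X)"
proof -
  interpret alg: algebra UNIV cylinders by (rule algebra_cylinders)
  have g0: "g {} = 0" using g(3)[of "{}" "{}"] by simp
  define f where "f A = ennreal (g (A \<inter> X))" for A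
  have "\<exists>m. (\<forall>s\<in>cylinders. m s = f s) \<and> measure_space UNIV (sigma_sets UNIV cylinders) m"
  proof (rule alg.caratheodory_empty_continuous)
    show "positive cylinders f" by (simp add: positive_def f_def g0)
    show "additive cylinders f"
      unfolding additive_def
    proof (intro ballI impI)
      fix A B :: "(int \<Rightarrow> bool) set" assume "A \<inter> B = {}"
      then have "g ((A \<union> B) \<inter> X) = g (A \<inter> X) + g (B \<inter> X)"
        by (subst g(3)[symmetric]) (auto simp: Int_Un_distrib2)
      then show "f (A \<union> B) = f A + f B" by (simp add: f_def ennreal_plus g(1))
    qed
    show "f A \<noteq> \<infinity>" for A by (simp add: f_def)
    fix A :: "nat \<Rightarrow> (int \<Rightarrow> bool) set"
    assume A: "range A \<subseteq> cylinders" "decseq A" "(\<Inter>i. A i) = {}"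
    have "closed (A i)" for i
    proof -
      have "A i \<in> cylinders" using A(1) by auto
      then obtain n B where "A i = trunc (window n) -` B" unfolding cylinders_def by blast
      then show ?thesis by (simp add: closed_trunc_vimage)
    qed
    then have "UNIV \<inter> (\<Inter>i\<in>UNIV. A i) \<noteq> {}" if ne: "\<And>i. A i \<noteq> {}"
    proof (rule compact_imp_fip_image[where f = A, OF compact_UNIV_configurations])
      fix I :: "nat set" assume I: "finite I"
      have "A (Max (insert 0 I)) \<subseteq> A i" if "i \<in> I" for i
        by (rule decseqD[OF A(2)]) (use I that in simp)
      then show "UNIV \<inter> (\<Inter>i\<in>I. A i) \<noteq> {}" using ne[of "Max (insert 0 I)"] by blast
    qed
    then obtain k where k: "A k = {}" using A(3) by auto
    have "f (A i) = 0" if "i \<ge> k" for i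
      using decseqD[OF A(2) that] k by (simp add: f_def g0)
    then show "(\<lambda>i. f (A i)) \<longlonglongrightarrow> 0"
      by (intro tendsto_eventually eventually_sequentiallyI[of k])
  qed
  then obtain m where m: "\<And>s. s \<in> cylinders \<Longrightarrow> m s = f s"
    "measure_space UNIV (sigma_sets UNIV cylinders) m" by blast
  define M where "M = measure_of UNIV (sigma_sets UNIV cylinders) m"
  have sM: "sets M = sets borel"
    unfolding M_def sets_borel_cylinders by (simp add: sigma_sets_sigma_sets_eq)
  have spM: "space M = UNIV" unfolding M_def by simp
  have eM: "emeasure M C = f C" if "C \<in> cylinders" for C
    unfolding M_def
    using m that
    by (subst emeasure_measure_of_sigma) (auto simp: measure_space_def)
  have Xb: "X \<in> sets M" using subshift_closed[OF X] sM by simp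
  \<comment> \<open>The complement of \<open>X\<close> is a countable union of cylinders, which the mean does not charge.\<close>
  have "emeasure M (- X) = 0"
  proof -
    define V where "V n = trunc (window n) -` {z. trunc (window n) -` {z} \<subseteq> - X}" for n
    have eq: "- X = (\<Union>n. V n)"
      unfolding V_def using subshift_closed[OF X] by (intro open_eq_Union_cylinders) auto
    have "V n \<in> null_sets M" for n
    proof (rule null_setsI)
      have V: "V n \<in> cylinders" unfolding V_def by (simp only: vimage_trunc_in_cylinders finite_window)
      have "V n \<inter> X = {}" unfolding V_def by auto
      then show "emeasure M (V n) = 0" by (simp add: eM[OF V] f_def g0)
      show "V n \<in> sets M" using V by (simp add: sM cylinders_borel)
    qed
    then have "(\<Union>n. V n) \<in> null_sets M" by (rule null_sets_UN)
    then show ?thesis using eq by (auto simp: null_sets_def)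
  qed
  moreover have eU: "emeasure M UNIV = 1" using eM[OF alg.top] by (simp add: f_def g(2))
  ultimately have AE: "AE x in M. x \<in> X"
    by (intro AE_I[where N = "- X"]) (auto simp: spM sM subshift_closed[OF X] borel_closed)
  define \<mu> where "\<mu> = restrict_space M X"
  have smu: "sets \<mu> = sets (restrict_space borel X)" unfolding \<mu>_def sets_restrict_space sM ..
  have spmu: "space \<mu> = X" by (rule sets_borel_restrictD[OF smu])
  have emu: "emeasure \<mu> (C \<inter> X) = ennreal (g (C \<inter> X))" if "C \<in> cylinders" for C
  proof -
    have "C \<in> sets M" using that sM cylinders_borel by simp
    have "emeasure \<mu> (C \<inter> X) = emeasure M (C \<inter> X)"
      unfolding \<mu>_def using Xb by (intro emeasure_restrict_space) (auto simp: spM)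
    also have "\<dots> = emeasure M C"
      by (rule emeasure_eq_AE) (use AE Xb \<open>C \<in> sets M\<close> in auto)
    finally show ?thesis using eM[OF that] by (simp add: f_def)
  qed
  have prob: "prob_space \<mu>"
    by (rule prob_spaceI) (use emu[OF alg.top] g(2) spmu in simp)
  then interpret prob_space \<mu> .
  have mmu: "measure \<mu> (C \<inter> X) = g (C \<inter> X)" if "C \<in> cylinders" for C
    using emu[OF that] g(1) by (simp add: emeasure_eq_measure)
  have meas: "shift \<in> \<mu> \<rightarrow>\<^sub>M \<mu>"
    using measurable_shift_restrict[OF X] by (simp add: measurable_cong_sets[OF smu smu])
  have "distr \<mu> \<mu> shift = \<mu>"
  proof (rule prob_measure_eqI_cylinders[OF subshift_closed[OF X]])
    show "prob_space (distr \<mu> \<mu> shift)" by (rule prob_space_distr[OF meas])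
    fix C :: "(int \<Rightarrow> bool) set" assume C: "C \<in> cylinders"
    have "measure (distr \<mu> \<mu> shift) (C \<inter> X) = measure \<mu> (shift -` (C \<inter> X) \<inter> space \<mu>)"
      using C smu cylinders_borel by (intro measure_distr meas sets_borel_restrictD(2)) auto
    also have "shift -` (C \<inter> X) \<inter> space \<mu> = shift -` C \<inter> X"
      using subshift_shift_iff[OF X] by (auto simp: spmu)
    also have "measure \<mu> \<dots> = g (shift -` C \<inter> X)"
      using shift_vimage_cylinder[OF C, of 1] by (intro mmu) simp
    also have "shift -` C \<inter> X = shift -` (C \<inter> X)" using subshift_shift_iff[OF X] by auto
    finally show "measure (distr \<mu> \<mu> shift) (C \<inter> X) = measure \<mu> (C \<inter> X)"
      unfolding g(4) mmu[OF C] .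
  qed (use prob smu in auto)
  then have "\<mu> \<in> invariant_measures shift X"
    unfolding invariant_measures_def using prob smu meas by simp
  then show ?thesis using mmu by blast
qed

text \<open>
  Points in which a cylinder is too frequent along arbitrarily long segments would produce a second
  invariant measure.
\<close>

lemma uniform_upper_frequency:
  assumes X: "subshift X" and ue: "uniquely_ergodic shift X" and \<nu>: "\<nu> \<in> invariant_measures shift X"
    and C: "C \<in> cylinders" and e: "e > 0"
  shows "\<forall>\<^sub>F n in sequentially. \<forall>x\<in>X. frequency n x C < measure \<nu> (C \<inter> X) + e"
proof (rule ccontr)
  assume neg: "\<not> ?thesis"
  have ex: "\<exists>n\<ge>m. \<exists>x\<in>X. measure \<nu> (C \<inter> X) + e \<le> frequency n x (C \<inter> X)" for m
  proof -
    obtain n x where "n \<ge> m" "x \<in> X" "measure \<nu> (C \<inter> X) + e \<le> frequency n x C"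
      using neg by (force simp: eventually_sequentially not_less)
    moreover have "frequency n x C = frequency n x (C \<inter> X)" if "x \<in> X"
      using that unfolding frequency_def by (simp add: indicator_inter_arith subshift_funpow_iff[OF X])
    ultimately show ?thesis by auto
  qed
  obtain g where g: "\<And>A. 0 \<le> g A" "g X = 1" "\<And>A B. A \<inter> B = {} \<Longrightarrow> g (A \<union> B) = g A + g B"
      "\<And>A. g (shift -` A) = g A" "measure \<nu> (C \<inter> X) + e \<le> g (C \<inter> X)"
    using invariant_mean_of_frequencies[OF X ex] by blast
  have "\<exists>\<mu>\<in>invariant_measures shift X. \<forall>C\<in>cylinders. measure \<mu> (C \<inter> X) = g (C \<inter> X)"
    by (rule invariant_measure_of_mean[OF X]) (fact g)+
  then obtain \<mu> where \<mu>: "\<mu> \<in> invariant_measures shift X"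
      "\<And>C. C \<in> cylinders \<Longrightarrow> measure \<mu> (C \<inter> X) = g (C \<inter> X)" by blast
  have "\<mu> = \<nu>" using ue \<mu>(1) \<nu> unfolding uniquely_ergodic_def by blast
  then show False using \<mu>(2)[OF C] g(5) e by simp
qed

lemma uniform_frequency:
  assumes X: "subshift X" and ue: "uniquely_ergodic shift X" and \<nu>: "\<nu> \<in> invariant_measures shift X"
    and C: "C \<in> cylinders" and e: "e > 0"
  shows "\<forall>\<^sub>F n in sequentially. \<forall>x\<in>X. \<bar>frequency n x C - measure \<nu> (C \<inter> X)\<bar> < e"
proof -
  interpret alg: algebra UNIV cylinders by (rule algebra_cylinders)
  have p: "prob_space \<nu>" and s: "sets \<nu> = sets (restrict_space borel X)"
    using \<nu> by (auto simp: invariant_measures_def)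
  interpret prob_space \<nu> by (rule p)
  have C': "- C \<in> cylinders" using alg.compl_sets[OF C] by (simp add: Compl_eq_Diff_UNIV)
  have "- C \<inter> X = space \<nu> - C \<inter> X" using sets_borel_restrictD(1)[OF s] by auto
  then have mc: "measure \<nu> (- C \<inter> X) = 1 - measure \<nu> (C \<inter> X)"
    using sets_borel_restrictD(2)[OF s cylinders_borel[OF C]] by (simp add: prob_compl)
  show ?thesis
    using uniform_upper_frequency[OF X ue \<nu> C e] uniform_upper_frequency[OF X ue \<nu> C' e]
      eventually_gt_at_top[of 0]
  proof eventually_elim
    case (elim n)
    have "frequency n x (- C) = 1 - frequency n x C" for x
      using \<open>0 < n\<close> unfolding frequency_def
      by (simp add: indicator_compl sum_subtractf diff_divide_distrib)
    then show ?case using elim(1,2) mc by (fastforce simp: abs_less_iff)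
  qed
qed

lemma sum_range_trunc_indicator:
  fixes F :: "(int \<Rightarrow> bool) \<Rightarrow> real"
  assumes "finite J"
  shows "F (trunc J x) = (\<Sum>z\<in>range (trunc J). F z * indicator (trunc J -` {z}) x)"
  using finite_range_trunc[OF assms]
  by (subst sum.remove[of _ "trunc J x"]) (auto intro!: sum.neutral simp: indicator_def)

lemma integral_cylinder_function:
  fixes F :: "(int \<Rightarrow> bool) \<Rightarrow> real"
  assumes p: "prob_space \<mu>" and s: "sets \<mu> = sets (restrict_space borel Y)" and J: "finite J"
  shows "(\<integral>x. F (trunc J x) \<partial>\<mu>) = (\<Sum>z\<in>range (trunc J). F z * measure \<mu> (trunc J -` {z} \<inter> Y))"
    and "integrable \<mu> (\<lambda>x. F (trunc J x))"
proof -
  interpret prob_space \<mu> by (rule p)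
  have [simp]: "trunc J -` {z} \<inter> space \<mu> \<in> sets \<mu>" for z
    using sets_borel_restrictD(4)[OF s J] sets_borel_restrictD(1)[OF s] by simp
  have meas: "(\<lambda>x. F (trunc J x)) \<in> borel_measurable \<mu>"
    by (rule measurable_compose[OF sets_borel_restrictD(3)[OF s J]]) simp
  have "(\<integral>x. F (trunc J x) \<partial>\<mu>) =
      (\<integral>x. (\<Sum>z\<in>range (trunc J). F z * indicator (trunc J -` {z} \<inter> space \<mu>) x) \<partial>\<mu>)"
    by (rule Bochner_Integration.integral_cong[OF refl], subst sum_range_trunc_indicator[OF J])
       (auto intro!: sum.cong simp: indicator_def)
  also have "\<dots> = (\<Sum>z\<in>range (trunc J). F z * measure \<mu> (trunc J -` {z} \<inter> space \<mu>))"
    by (subst Bochner_Integration.integral_sum)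
       (auto intro!: integrable_mult_right simp: emeasure_eq_measure)
  finally show "(\<integral>x. F (trunc J x) \<partial>\<mu>) = (\<Sum>z\<in>range (trunc J). F z * measure \<mu> (trunc J -` {z} \<inter> Y))"
    by (simp add: sets_borel_restrictD(1)[OF s])
  have "finite (F ` range (trunc J))" by (intro finite_imageI finite_range_trunc J)
  then have "norm (F (trunc J x)) \<le> Max (norm ` F ` range (trunc J))" for x
    by (intro Max_ge) auto
  then show "integrable \<mu> (\<lambda>x. F (trunc J x))"
    by (intro integrable_const_bound[where B = "Max (norm ` F ` range (trunc J))"] meas) auto
qed

text \<open>
  A function of the coordinates in \<open>J\<close> is a linear combination of finitely many cylinders.
\<close>

lemma uniform_average:
  fixes F :: "(int \<Rightarrow> bool) \<Rightarrow> real"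
  assumes X: "subshift X" and ue: "uniquely_ergodic shift X" and \<nu>: "\<nu> \<in> invariant_measures shift X"
    and J: "finite J" and e: "e > 0"
  shows "\<forall>\<^sub>F n in sequentially. \<forall>x\<in>X.
    \<bar>(\<Sum>i<n. F (trunc J ((shift ^^ i) x))) / real n - (\<integral>x. F (trunc J x) \<partial>\<nu>)\<bar> < e"
proof -
  have p: "prob_space \<nu>" and s: "sets \<nu> = sets (restrict_space borel X)"
    using \<nu> by (auto simp: invariant_measures_def)
  define R where "R = range (trunc J)"
  have R: "finite R" unfolding R_def by (rule finite_range_trunc[OF J])
  define S where "S = (\<Sum>z\<in>R. \<bar>F z\<bar>) + 1"
  have S: "S > 0" unfolding S_def by (simp add: add_nonneg_pos sum_nonneg)
  have "\<forall>\<^sub>F n in sequentially. \<forall>z\<in>R. \<forall>x\<in>X.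
      \<bar>frequency n x (trunc J -` {z}) - measure \<nu> (trunc J -` {z} \<inter> X)\<bar> < e / S"
    using e S by (intro eventually_ball_finite R ballI uniform_frequency[OF X ue \<nu>]
        vimage_trunc_in_cylinders J) auto
  then show ?thesis
  proof eventually_elim
    case (elim n)
    show ?case
    proof
      fix x assume x: "x \<in> X"
      have "(\<Sum>i<n. F (trunc J ((shift ^^ i) x))) / real n =
          (\<Sum>z\<in>R. F z * frequency n x (trunc J -` {z}))"
        unfolding R_def
        by (subst sum_range_trunc_indicator[OF J], subst sum.swap)
           (simp add: frequency_def sum_distrib_left[symmetric], subst sum_divide_distrib, simp)
      moreover have "(\<integral>x. F (trunc J x) \<partial>\<nu>) = (\<Sum>z\<in>R. F z * measure \<nu> (trunc J -` {z} \<inter> X))"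
        unfolding R_def by (rule integral_cylinder_function[OF p s J])
      ultimately have "\<bar>(\<Sum>i<n. F (trunc J ((shift ^^ i) x))) / real n - (\<integral>x. F (trunc J x) \<partial>\<nu>)\<bar> =
          \<bar>\<Sum>z\<in>R. F z * (frequency n x (trunc J -` {z}) - measure \<nu> (trunc J -` {z} \<inter> X))\<bar>"
        by (simp add: sum_subtractf right_diff_distrib)
      also have "\<dots> \<le> (\<Sum>z\<in>R. \<bar>F z\<bar> * (e / S))"
      proof (rule order_trans[OF sum_abs], rule sum_mono)
        fix z assume "z \<in> R"
        then have "\<bar>frequency n x (trunc J -` {z}) - measure \<nu> (trunc J -` {z} \<inter> X)\<bar> \<le> e / S"
          using elim x by (blast intro: less_imp_le)
        then show "\<bar>F z * (frequency n x (trunc J -` {z}) - measure \<nu> (trunc J -` {z} \<inter> X))\<bar> \<le> \<bar>F z\<bar> * (e / S)"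
          unfolding abs_mult by (rule mult_left_mono) simp
      qed
      also have "\<dots> < S * (e / S)"
        unfolding sum_distrib_right[symmetric] by (rule mult_strict_right_mono) (use e S in \<open>auto simp: S_def\<close>)
      finally show "\<bar>(\<Sum>i<n. F (trunc J ((shift ^^ i) x))) / real n - (\<integral>x. F (trunc J x) \<partial>\<nu>)\<bar> < e"
        using S by simp
    qed
  qed
qed

section \<open>Extreme invariant measures\<close>

lemma invariant_measuresD:
  assumes "\<mu> \<in> invariant_measures shift Y"
  shows "prob_space \<mu>" "sets \<mu> = sets (restrict_space borel Y)" "shift \<in> \<mu> \<rightarrow>\<^sub>M \<mu>" "distr \<mu> \<mu> shift = \<mu>"
    "space \<mu> = Y"
  using assms sets_borel_restrictD(1)[of \<mu> Y] by (auto simp: invariant_measures_def)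

lemma distr_shift_funpow:
  assumes "\<mu> \<in> invariant_measures shift Y"
  shows "(shift ^^ n) \<in> \<mu> \<rightarrow>\<^sub>M \<mu>" "distr \<mu> \<mu> (shift ^^ n) = \<mu>"
proof -
  note \<mu> = invariant_measuresD[OF assms]
  have "(shift ^^ n) \<in> \<mu> \<rightarrow>\<^sub>M \<mu> \<and> distr \<mu> \<mu> (shift ^^ n) = \<mu>"
  proof (induction n)
    case 0
    then show ?case by (simp add: id_def distr_id)
  next
    case (Suc n)
    then show ?case
      using \<mu>(3,4) distr_distr[of shift \<mu> \<mu> "shift ^^ n" \<mu>] by (simp add: measurable_comp o_def)
  qed
  then show "(shift ^^ n) \<in> \<mu> \<rightarrow>\<^sub>M \<mu>" "distr \<mu> \<mu> (shift ^^ n) = \<mu>" by auto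
qed

lemma integral_shift_funpow:
  fixes f :: "(int \<Rightarrow> bool) \<Rightarrow> real"
  assumes "\<mu> \<in> invariant_measures shift Y" "f \<in> borel_measurable \<mu>"
  shows "(\<integral>x. f ((shift ^^ n) x) \<partial>\<mu>) = (\<integral>x. f x \<partial>\<mu>)"
  using integral_distr[OF distr_shift_funpow(1)[OF assms(1)] assms(2), of n]
  by (simp add: distr_shift_funpow(2)[OF assms(1)])

lemma measure_shift_funpow:
  assumes "\<mu> \<in> invariant_measures shift Y" "A \<in> sets \<mu>"
  shows "measure \<mu> ((shift ^^ n) -` A \<inter> Y) = measure \<mu> A"
  using measure_distr[OF distr_shift_funpow(1)[OF assms(1)] assms(2), of n]
  by (simp add: distr_shift_funpow(2)[OF assms(1)] invariant_measuresD(5)[OF assms(1)])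

lemma frequency_eq_sum:
  "frequency n x C = (\<Sum>i<n. indicator ((shift ^^ i) -` C) x) / real n"
  unfolding frequency_def by (simp add: indicator_def)

lemma measurable_frequency:
  assumes "C \<in> cylinders" shows "(\<lambda>x. frequency n x C) \<in> borel_measurable borel"
  unfolding frequency_eq_sum
  by (intro borel_measurable_divide borel_measurable_sum borel_measurable_indicator
      cylinders_borel shift_vimage_cylinder assms) auto

lemma measurable_restrictI:
  "f \<in> borel \<rightarrow>\<^sub>M M \<Longrightarrow> sets \<mu> = sets (restrict_space borel Y) \<Longrightarrow> f \<in> \<mu> \<rightarrow>\<^sub>M M"
  by (simp add: measurable_cong_sets[of \<mu> "restrict_space borel Y" M M] measurable_restrict_space1)

lemma integral_frequency:
  assumes \<mu>: "\<mu> \<in> invariant_measures shift Y" and Y: "subshift Y" and C: "C \<in> cylinders" and n: "n > 0"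
  shows "(\<integral>x. frequency n x C \<partial>\<mu>) = measure \<mu> (C \<inter> Y)"
proof -
  note D = invariant_measuresD[OF \<mu>]
  interpret prob_space \<mu> by (rule D)
  have sh: "(shift ^^ i) -` C \<inter> Y \<in> sets \<mu>" for i
    by (intro sets_borel_restrictD(2)[OF D(2)] cylinders_borel shift_vimage_cylinder C)
  have "(\<integral>x. frequency n x C \<partial>\<mu>) = (\<integral>x. (\<Sum>i<n. indicator ((shift ^^ i) -` C \<inter> Y) x) / real n \<partial>\<mu>)"
    unfolding frequency_eq_sum
    by (intro Bochner_Integration.integral_cong refl arg_cong2[where f = "(/)"] sum.cong)
       (auto simp: D(5) indicator_def)
  also have "\<dots> = (\<Sum>i<n. measure \<mu> ((shift ^^ i) -` C \<inter> Y)) / real n"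
    using sh by (subst integral_divide_zero, subst Bochner_Integration.integral_sum)
      (auto simp: emeasure_eq_measure D(5) Int_absorb2)
  also have "(shift ^^ i) -` C \<inter> Y = (shift ^^ i) -` (C \<inter> Y) \<inter> Y" for i
    by (auto simp: subshift_funpow_iff[OF Y])
  then have "(\<Sum>i<n. measure \<mu> ((shift ^^ i) -` C \<inter> Y)) = (\<Sum>i<n. measure \<mu> (C \<inter> Y))"
    using measure_shift_funpow[OF \<mu> sh[of 0]] by simp
  finally show ?thesis using n by simp
qed

text \<open>
  Frequencies that converge to a constant in mean square for \<open>\<mu>\<close> do so for \<open>\<nu> \<le> \<mu> / t\<close>. Since the
  mean of the frequency of \<open>C\<close> is the measure of \<open>C\<close> for any invariant measure, both measures
  agree on \<open>C\<close>.
\<close>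

lemma dominated_invariant_measure_eq:
  assumes Y: "subshift Y" and \<mu>: "\<mu> \<in> invariant_measures shift Y" and \<nu>: "\<nu> \<in> invariant_measures shift Y"
    and t: "t > 0" and dom: "\<And>A. A \<in> sets \<mu> \<Longrightarrow> t * measure \<nu> A \<le> measure \<mu> A"
    and var: "\<And>C e. C \<in> cylinders \<Longrightarrow> e > 0 \<Longrightarrow>
      \<exists>n>0. (\<integral>x. (frequency n x C - measure \<mu> (C \<inter> Y))\<^sup>2 \<partial>\<mu>) < e"
  shows "\<nu> = \<mu>"
proof (rule prob_measure_eqI_cylinders[OF subshift_closed[OF Y]])
  note D = invariant_measuresD[OF \<mu>] and D' = invariant_measuresD[OF \<nu>]
  show "prob_space \<nu>" "prob_space \<mu>" "sets \<nu> = sets (restrict_space borel Y)"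
    "sets \<mu> = sets (restrict_space borel Y)" by (fact D D')+
  interpret m: prob_space \<mu> by fact
  interpret n: prob_space \<nu> by fact
  fix C :: "(int \<Rightarrow> bool) set" assume C: "C \<in> cylinders"
  define c where "c = measure \<mu> (C \<inter> Y)"
  have "t * (measure \<nu> (C \<inter> Y) - c)\<^sup>2 \<le> 0 + e" if e: "e > 0" for e
  proof -
    obtain n where n: "n > 0" "(\<integral>x. (frequency n x C - c)\<^sup>2 \<partial>\<mu>) < e"
      using var[OF C e] unfolding c_def by blast
    define f where "f x = frequency n x C - c" for x
    have f: "f \<in> borel_measurable borel"
      unfolding f_def by (intro borel_measurable_diff measurable_frequency C) auto
    have c: "0 \<le> c" "c \<le> 1" by (auto simp: c_def)
    have b: "\<bar>f x\<bar> \<le> 1" for x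
      using frequency_bounds[of n x C] c unfolding f_def by (auto simp: abs_le_iff)
    have b2: "(f x)\<^sup>2 \<le> 1" for x using b[of x] by (simp add: abs_square_le_1)
    have int: "integrable \<nu> f" "integrable \<nu> (\<lambda>x. (f x)\<^sup>2)" "integrable \<mu> (\<lambda>x. (f x)\<^sup>2)"
      using measurable_restrictI[OF f D(2)] measurable_restrictI[OF f D'(2)] b b2
      by (auto intro!: n.integrable_const_bound[where B = 1] m.integrable_const_bound[where B = 1])
    have "(\<integral>x. f x \<partial>\<nu>) = measure \<nu> (C \<inter> Y) - c"
    proof -
      have "integrable \<nu> (\<lambda>x. frequency n x C)"
        using measurable_restrictI[OF measurable_frequency[OF C] D'(2)]
        by (intro n.integrable_const_bound[where B = 1]) (auto simp: frequency_bounds)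
      then show ?thesis
        unfolding f_def using integral_frequency[OF \<nu> Y C n(1)] by (simp add: n.prob_space)
    qed
    \<comment> \<open>The squared mean is at most the mean square, since the variance is nonnegative.\<close>
    then have "(measure \<nu> (C \<inter> Y) - c)\<^sup>2 \<le> (\<integral>x. (f x)\<^sup>2 \<partial>\<nu>)"
      using n.variance_positive[of f] unfolding n.variance_eq[OF int(1,2)] by simp
    moreover have "t * (\<integral>x. (f x)\<^sup>2 \<partial>\<nu>) \<le> (\<integral>x. (f x)\<^sup>2 \<partial>\<mu>)"
    proof -
      have "(\<integral>\<^sup>+x. ennreal ((f x)\<^sup>2) \<partial>scale_measure (ennreal t) \<nu>) \<le> (\<integral>\<^sup>+x. ennreal ((f x)\<^sup>2) \<partial>\<mu>)"
      proof (rule nn_integral_mono_measure)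
        show "sets (scale_measure (ennreal t) \<nu>) = sets \<mu>" by (simp add: D(2) D'(2))
        show "scale_measure (ennreal t) \<nu> \<le> \<mu>"
          using dom t
          by (subst le_measure) (auto simp: D(2) D'(2) n.emeasure_eq_measure m.emeasure_eq_measure
              ennreal_mult[symmetric] intro!: ennreal_leI)
      qed
      moreover have "(\<lambda>x. ennreal ((f x)\<^sup>2)) \<in> borel_measurable \<nu>"
        using int(2) by (auto dest: borel_measurable_integrable)
      ultimately have "ennreal t * ennreal (\<integral>x. (f x)\<^sup>2 \<partial>\<nu>) \<le> ennreal (\<integral>x. (f x)\<^sup>2 \<partial>\<mu>)"
        using int by (simp add: nn_integral_scale_measure nn_integral_eq_integral)
      then show ?thesis using t by (simp add: ennreal_mult[symmetric] ennreal_le_iff)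
    qed
    ultimately have "t * (measure \<nu> (C \<inter> Y) - c)\<^sup>2 \<le> (\<integral>x. (f x)\<^sup>2 \<partial>\<mu>)"
      using t by (meson mult_left_mono order_trans less_imp_le)
    then show ?thesis using n(2) unfolding f_def by simp
  qed
  then have "t * (measure \<nu> (C \<inter> Y) - c)\<^sup>2 \<le> 0" by (rule field_le_epsilon)
  then show "measure \<nu> (C \<inter> Y) = measure \<mu> (C \<inter> Y)"
    using t by (simp add: mult_le_0_iff c_def)
qed

lemma extreme_measureI:
  assumes Y: "subshift Y" and \<mu>: "\<mu> \<in> invariant_measures shift Y"
    and var: "\<And>C e. C \<in> cylinders \<Longrightarrow> e > 0 \<Longrightarrow>
      \<exists>n>0. (\<integral>x. (frequency n x C - measure \<mu> (C \<inter> Y))\<^sup>2 \<partial>\<mu>) < e"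
  shows "\<mu> \<in> extreme_measures (invariant_measures shift Y)"
  unfolding extreme_measures_def
proof (intro CollectI conjI ballI allI impI \<mu>)
  fix \<nu>1 \<nu>2 t
  assume n: "\<nu>1 \<in> invariant_measures shift Y" "\<nu>2 \<in> invariant_measures shift Y"
    and t: "0 < t" "t < (1::real)"
    and eq: "\<forall>A\<in>sets \<mu>. measure \<mu> A = t * measure \<nu>1 A + (1 - t) * measure \<nu>2 A"
  show "\<nu>1 = \<mu>"
    by (rule dominated_invariant_measure_eq[OF Y \<mu> n(1) t(1) _ var]) (use eq t in auto)
  show "\<nu>2 = \<mu>"
    by (rule dominated_invariant_measure_eq[OF Y \<mu> n(2) _ _ var, of "1 - t"]) (use eq t in auto)
qed

section \<open>The weak topology and finite windows\<close>

text \<open>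
  Comparing all events on the window, rather than single words, makes closeness pass to smaller windows with
  the same \<open>d\<close>.
\<close>

definition window_close :: "(int \<Rightarrow> bool) set \<Rightarrow> nat \<Rightarrow> real \<Rightarrow> (int \<Rightarrow> bool) measure \<Rightarrow> (int \<Rightarrow> bool) measure \<Rightarrow> bool" where
  "window_close Y n d \<mu> \<nu> \<longleftrightarrow>
     (\<forall>B. \<bar>measure \<nu> (trunc (window n) -` B \<inter> Y) - measure \<mu> (trunc (window n) -` B \<inter> Y)\<bar> < d)"

lemma window_close_mono:
  assumes "window_close Y n d \<mu> \<nu>" "m \<le> n" "d \<le> e" shows "window_close Y m e \<mu> \<nu>"
  unfolding window_close_def
proof
  fix B
  show "\<bar>measure \<nu> (trunc (window m) -` B \<inter> Y) - measure \<mu> (trunc (window m) -` B \<inter> Y)\<bar> < e"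
    using spec[OF assms(1)[unfolded window_close_def], of "trunc (window m) -` B"] assms(3)
    by (simp only: cylinder_window_mono[OF assms(2), of B, symmetric])
qed

text \<open>
  A continuous function is uniformly close to \<open>f \<circ> trunc (window n)\<close>, which takes finitely many values;
  this composition makes sense because a hereditary set is closed under truncation.
\<close>

lemma integral_near_of_window_close:
  fixes f :: "(int \<Rightarrow> bool) \<Rightarrow> real"
  assumes Y: "closed Y" "hereditary Y" and f: "continuous_on Y f" and e: "e > 0"
  obtains n d where "d > 0" "\<And>\<mu> \<nu>. \<mu> \<in> invariant_measures shift Y \<Longrightarrow> \<nu> \<in> invariant_measures shift Y \<Longrightarrow>
    window_close Y n d \<mu> \<nu> \<Longrightarrow> \<bar>(\<integral>x. f x \<partial>\<nu>) - (\<integral>x. f x \<partial>\<mu>)\<bar> < e"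
proof -
  obtain n where "\<And>x. x \<in> Y \<Longrightarrow>
      (\<forall>y\<in>trunc (window n) -` {trunc (window n) x} \<inter> Y. \<forall>z\<in>trunc (window n) -` {trunc (window n) x} \<inter> Y.
        \<bar>f y - f z\<bar> \<le> e / 4)"
  proof (rule uniform_window[OF Y(1), where P = "\<lambda>A. \<forall>y\<in>A. \<forall>z\<in>A. \<bar>f y - f z\<bar> \<le> e / 4"])
    fix x assume x: "x \<in> Y"
    have "\<exists>U. open U \<and> U \<inter> Y = f -` ball (f x) (e / 8) \<inter> Y"
      using f open_ball[of "f x" "e / 8"] by (simp add: continuous_on_open_invariant)
    then obtain U where U: "open U" "f -` ball (f x) (e / 8) \<inter> Y = U \<inter> Y" by blast
    have "\<forall>y\<in>U \<inter> Y. \<forall>z\<in>U \<inter> Y. \<bar>f y - f z\<bar> \<le> e / 4"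
    proof (intro ballI)
      fix y z assume "y \<in> U \<inter> Y" "z \<in> U \<inter> Y"
      then have "dist (f x) (f y) < e / 8" "dist (f x) (f z) < e / 8" using U(2) by auto
      then show "\<bar>f y - f z\<bar> \<le> e / 4" by (simp add: dist_real_def abs_if split: if_splits)
    qed
    moreover have "x \<in> U" using U(2) x e by (metis IntD1 IntI centre_in_ball vimageI divide_pos_pos zero_less_numeral)
    ultimately show "\<exists>U. open U \<and> x \<in> U \<and> (\<forall>y\<in>U \<inter> Y. \<forall>z\<in>U \<inter> Y. \<bar>f y - f z\<bar> \<le> e / 4)" using U(1) by blast
  qed auto
  note n = this
  let ?r = "trunc (window n)"
  have near: "\<bar>f x - f (?r x)\<bar> \<le> e / 4" if "x \<in> Y" for x
  proof -
    have "?r x \<in> Y" using Y(2) that trunc_le unfolding hereditary_def by blast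
    then show ?thesis using n[OF that] that by (auto simp: trunc_trunc)
  qed
  define R where "R = range ?r"
  have R: "finite R" unfolding R_def by (rule finite_range_trunc) simp
  define S where "S = (\<Sum>z\<in>R. \<bar>f z\<bar>) + 1"
  have S: "S > 0" unfolding S_def by (simp add: add_nonneg_pos sum_nonneg)
  have step: "\<bar>(\<integral>x. f x \<partial>\<mu>) - (\<Sum>z\<in>R. f z * measure \<mu> (?r -` {z} \<inter> Y))\<bar> \<le> e / 4"
    if \<mu>: "\<mu> \<in> invariant_measures shift Y" for \<mu>
  proof -
    note D = invariant_measuresD[OF \<mu>]
    interpret prob_space \<mu> by (rule D)
    have mf: "f \<in> borel_measurable \<mu>"
      using borel_measurable_continuous_on_restrict[OF f] by (simp add: measurable_cong_sets[OF D(2) refl])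
    have "bounded (f ` Y)"
      by (intro compact_imp_bounded compact_continuous_image f compact_closed_configurations Y)
    then obtain B where "\<forall>x\<in>Y. norm (f x) \<le> B" by (auto simp: bounded_iff)
    then have i1: "integrable \<mu> f"
      by (intro integrable_const_bound[where B = B] mf AE_I2) (auto simp: D(5))
    have i2: "integrable \<mu> (\<lambda>x. f (?r x))"
      by (rule integral_cylinder_function(2)[OF D(1,2)]) simp
    have "(\<Sum>z\<in>R. f z * measure \<mu> (?r -` {z} \<inter> Y)) = (\<integral>x. f (?r x) \<partial>\<mu>)"
      unfolding R_def by (rule integral_cylinder_function(1)[OF D(1,2), symmetric]) simp
    then have "\<bar>(\<integral>x. f x \<partial>\<mu>) - (\<Sum>z\<in>R. f z * measure \<mu> (?r -` {z} \<inter> Y))\<bar> = \<bar>\<integral>x. f x - f (?r x) \<partial>\<mu>\<bar>"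
      using i1 i2 by simp
    also have "\<dots> \<le> (\<integral>x. \<bar>f x - f (?r x)\<bar> \<partial>\<mu>)" by (rule integral_abs_bound)
    also have "\<dots> \<le> (\<integral>x. e / 4 \<partial>\<mu>)"
      using i1 i2 near by (intro integral_mono) (auto simp: D(5))
    finally show ?thesis by (simp add: prob_space)
  qed
  show ?thesis
  proof (rule that[of "e / 4 / S" n])
    show "e / 4 / S > 0" using e S by simp
    fix \<mu> \<nu> assume m: "\<mu> \<in> invariant_measures shift Y" "\<nu> \<in> invariant_measures shift Y"
      "window_close Y n (e / 4 / S) \<mu> \<nu>"
    have "\<bar>(\<Sum>z\<in>R. f z * measure \<nu> (?r -` {z} \<inter> Y)) - (\<Sum>z\<in>R. f z * measure \<mu> (?r -` {z} \<inter> Y))\<bar> =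
        \<bar>\<Sum>z\<in>R. f z * (measure \<nu> (?r -` {z} \<inter> Y) - measure \<mu> (?r -` {z} \<inter> Y))\<bar>"
      by (simp add: sum_subtractf right_diff_distrib)
    also have "\<dots> \<le> (\<Sum>z\<in>R. \<bar>f z\<bar> * (e / 4 / S))"
    proof (rule order_trans[OF sum_abs], rule sum_mono)
      fix z
      have "\<bar>measure \<nu> (?r -` {z} \<inter> Y) - measure \<mu> (?r -` {z} \<inter> Y)\<bar> \<le> e / 4 / S"
        using m(3) unfolding window_close_def by (blast intro: less_imp_le)
      then show "\<bar>f z * (measure \<nu> (?r -` {z} \<inter> Y) - measure \<mu> (?r -` {z} \<inter> Y))\<bar> \<le> \<bar>f z\<bar> * (e / 4 / S)"
        unfolding abs_mult by (rule mult_left_mono) simp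
    qed
    also have "\<dots> < S * (e / 4 / S)"
      unfolding sum_distrib_right[symmetric]
      by (rule mult_strict_right_mono) (use e S in \<open>auto simp: S_def\<close>)
    also have "\<dots> = e / 4" using S by simp
    finally show "\<bar>(\<integral>x. f x \<partial>\<nu>) - (\<integral>x. f x \<partial>\<mu>)\<bar> < e"
      using step[OF m(1)] step[OF m(2)] e by linarith
  qed
qed

lemma weak_neighbourhood_contains_window_close:
  assumes Y: "closed Y" "hereditary Y" and V: "openin (weak_topology shift Y) V" and \<mu>: "\<mu> \<in> V"
  shows "\<exists>n d. d > 0 \<and> (\<forall>\<nu>\<in>invariant_measures shift Y. window_close Y n d \<mu> \<nu> \<longrightarrow> \<nu> \<in> V)"
proof -
  have sub: "A \<subseteq> invariant_measures shift Y" if "openin (weak_topology shift Y) A" for A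
    using openin_subset[OF that] by (simp add: topspace_weak_topology)
  have "generate_topology_on {{\<mu> \<in> invariant_measures shift Y. (\<integral>x. f x \<partial>\<mu>) \<in> U} |
      (f :: (int \<Rightarrow> bool) \<Rightarrow> real) U. continuous_on Y f \<and> open U} V"
    using V unfolding weak_topology_def openin_topology_generated_by_iff .
  then have "\<forall>\<mu>\<in>V. \<exists>n d. d > 0 \<and> (\<forall>\<nu>\<in>invariant_measures shift Y. window_close Y n d \<mu> \<nu> \<longrightarrow> \<nu> \<in> V)"
  proof induction
    case Empty
    then show ?case by simp
  next
    case (Int a b)
    show ?case
    proof
      fix \<mu> assume "\<mu> \<in> a \<inter> b"
      with Int.IH obtain n d m e where *: "d > 0" "e > 0"
        "\<forall>\<nu>\<in>invariant_measures shift Y. window_close Y n d \<mu> \<nu> \<longrightarrow> \<nu> \<in> a"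
        "\<forall>\<nu>\<in>invariant_measures shift Y. window_close Y m e \<mu> \<nu> \<longrightarrow> \<nu> \<in> b" by (metis IntE)
      have "\<forall>\<nu>\<in>invariant_measures shift Y. window_close Y (max n m) (min d e) \<mu> \<nu> \<longrightarrow> \<nu> \<in> a \<inter> b"
        using * window_close_mono[where n = "max n m" and d = "min d e"] by auto
      moreover have "min d e > 0" using * by simp
      ultimately show "\<exists>n d. d > 0 \<and> (\<forall>\<nu>\<in>invariant_measures shift Y. window_close Y n d \<mu> \<nu> \<longrightarrow> \<nu> \<in> a \<inter> b)"
        by blast
    qed
  next
    case (UN K)
    show ?case
    proof
      fix \<mu> assume "\<mu> \<in> \<Union>K"
      then obtain k where k: "k \<in> K" "\<mu> \<in> k" by blast
      obtain n d where "d > 0" "\<forall>\<nu>\<in>invariant_measures shift Y. window_close Y n d \<mu> \<nu> \<longrightarrow> \<nu> \<in> k"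
        using bspec[OF UN.IH[OF k(1)] k(2)] by blast
      moreover from this(2) have "\<forall>\<nu>\<in>invariant_measures shift Y. window_close Y n d \<mu> \<nu> \<longrightarrow> \<nu> \<in> \<Union>K"
        using k(1) by blast
      ultimately show "\<exists>n d. d > 0 \<and> (\<forall>\<nu>\<in>invariant_measures shift Y. window_close Y n d \<mu> \<nu> \<longrightarrow> \<nu> \<in> \<Union>K)"
        by blast
    qed
  next
    case (Basis s)
    then obtain f :: "(int \<Rightarrow> bool) \<Rightarrow> real" and U where
      s: "s = {\<mu> \<in> invariant_measures shift Y. (\<integral>x. f x \<partial>\<mu>) \<in> U}" "continuous_on Y f" "open U" by blast
    show ?case
    proof
      fix \<mu> assume \<mu>: "\<mu> \<in> s"
      then obtain e where e: "e > 0" "ball (\<integral>x. f x \<partial>\<mu>) e \<subseteq> U"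
        using s openE by blast
      obtain n d where nd: "d > 0" "\<And>\<mu> \<nu>. \<mu> \<in> invariant_measures shift Y \<Longrightarrow> \<nu> \<in> invariant_measures shift Y \<Longrightarrow>
          window_close Y n d \<mu> \<nu> \<Longrightarrow> \<bar>(\<integral>x. f x \<partial>\<nu>) - (\<integral>x. f x \<partial>\<mu>)\<bar> < e"
        by (rule integral_near_of_window_close[OF Y s(2) e(1)]) (rule that, auto)
      have "\<nu> \<in> s" if "\<nu> \<in> invariant_measures shift Y" "window_close Y n d \<mu> \<nu>" for \<nu>
      proof -
        have "(\<integral>x. f x \<partial>\<nu>) \<in> ball (\<integral>x. f x \<partial>\<mu>) e"
          using nd(2)[OF _ that] \<mu> s(1) by (simp add: dist_real_def abs_minus_commute)
        then show ?thesis using e(2) s(1) that(1) by blast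
      qed
      then show "\<exists>n d. d > 0 \<and> (\<forall>\<nu>\<in>invariant_measures shift Y. window_close Y n d \<mu> \<nu> \<longrightarrow> \<nu> \<in> s)"
        using nd(1) by blast
    qed
  qed
  then show ?thesis using \<mu> by blast
qed

lemma weak_closure_eqI:
  assumes Y: "closed Y" "hereditary Y" and E: "E \<subseteq> invariant_measures shift Y"
    and dense: "\<And>\<mu> n d. \<mu> \<in> invariant_measures shift Y \<Longrightarrow> d > 0 \<Longrightarrow> \<exists>\<nu>\<in>E. window_close Y n d \<mu> \<nu>"
  shows "weak_topology shift Y closure_of E = invariant_measures shift Y"
proof
  show "weak_topology shift Y closure_of E \<subseteq> invariant_measures shift Y"
    using closure_of_subset_topspace by (metis topspace_weak_topology)
  show "invariant_measures shift Y \<subseteq> weak_topology shift Y closure_of E"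
  proof
    fix \<mu> assume \<mu>: "\<mu> \<in> invariant_measures shift Y"
    show "\<mu> \<in> weak_topology shift Y closure_of E"
      unfolding in_closure_of
    proof (intro conjI allI impI)
      show "\<mu> \<in> topspace (weak_topology shift Y)" using \<mu> by (simp add: topspace_weak_topology)
      fix V assume V: "\<mu> \<in> V \<and> openin (weak_topology shift Y) V"
      then obtain n d where nd: "d > 0"
          "\<And>\<nu>. \<nu> \<in> invariant_measures shift Y \<Longrightarrow> window_close Y n d \<mu> \<nu> \<Longrightarrow> \<nu> \<in> V"
        using weak_neighbourhood_contains_window_close[OF Y, of V \<mu>] by blast
      then show "\<exists>\<nu>. \<nu> \<in> E \<and> \<nu> \<in> V" using dense[OF \<mu> nd(1), of n] E by blast
    qed
  qed
qed

section \<open>Independent marks\<close>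

definition translate :: "int \<Rightarrow> (int \<Rightarrow> 'a) \<Rightarrow> (int \<Rightarrow> 'a)" where
  "translate j x = (\<lambda>k. x (k + j))"

lemma shift_funpow_translate: "shift ^^ n = translate (int n)"
  by (simp add: fun_eq_iff shift_funpow translate_def)

lemma translate_translate: "translate i (translate j x) = translate (i + j) x"
  by (simp add: translate_def add.assoc)

definition iid :: "'e pmf \<Rightarrow> (int \<Rightarrow> 'e) measure" where
  "iid Q = (\<Pi>\<^sub>M i\<in>UNIV. measure_pmf Q)"

lemma space_iid [simp]: "space (iid Q) = UNIV"
  by (simp add: iid_def space_PiM PiE_UNIV_domain)

lemma prob_space_iid: "prob_space (iid Q)"
  unfolding iid_def by (rule prob_space_PiM) (rule prob_space_measure_pmf)

lemma measure_iid_UNIV [simp]: "measure (iid Q) UNIV = 1"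
  using prob_space.prob_space[OF prob_space_iid[of Q]] by simp

lemma measurable_translate: "translate j \<in> iid Q \<rightarrow>\<^sub>M iid Q"
  unfolding iid_def translate_def
  by (rule measurable_abs_UNIV) simp

lemma distr_translate_iid: "distr (iid Q) (iid Q) (translate j) = iid Q"
proof -
  have "distr (\<Pi>\<^sub>M i\<in>UNIV. measure_pmf Q) (\<Pi>\<^sub>M i\<in>UNIV. measure_pmf Q) (\<lambda>\<omega>. \<lambda>n\<in>UNIV. \<omega> (n + j)) =
      (\<Pi>\<^sub>M i\<in>UNIV. measure_pmf Q)"
    by (rule distr_PiM_reindex[where M = "\<lambda>_. measure_pmf Q"])
       (auto simp: prob_space_measure_pmf inj_on_def)
  moreover have "(translate j :: (int \<Rightarrow> 'a) \<Rightarrow> _) = (\<lambda>\<omega> n. \<omega> (n + j))"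
    by (simp add: translate_def fun_eq_iff)
  ultimately show ?thesis by (simp add: iid_def restrict_UNIV)
qed

text \<open>
  Functions of disjoint sets of coordinates are independent. Each of them is a function of the
  restriction to its coordinates, after extending it arbitrarily to the other coordinates.
\<close>

lemma iid_integral_mult_disjoint:
  fixes f g :: "(int \<Rightarrow> 'e) \<Rightarrow> real"
  assumes f: "f \<in> borel_measurable (iid Q)" "\<And>e. \<bar>f e\<bar> \<le> 1"
    and g: "g \<in> borel_measurable (iid Q)" "\<And>e. \<bar>g e\<bar> \<le> 1"
    and loc: "\<And>e e'. (\<forall>i\<in>A. e i = e' i) \<Longrightarrow> f e = f e'" "\<And>e e'. (\<forall>i\<in>B. e i = e' i) \<Longrightarrow> g e = g e'"
    and disj: "A \<inter> B = {}"
  shows "(\<integral>e. f e * g e \<partial>iid Q) = (\<integral>e. f e \<partial>iid Q) * (\<integral>e. g e \<partial>iid Q)"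
proof -
  interpret prob_space "iid Q" by (rule prob_space_iid)
  interpret pr: product_prob_space "\<lambda>_::int. measure_pmf Q" UNIV
    by unfold_locales
  define d :: 'e where "d = undefined"
  define ext where "ext J r = (\<lambda>i. if i \<in> J then r i else d)" for J :: "int set" and r :: "int \<Rightarrow> 'e"
  have ext: "ext J \<in> (\<Pi>\<^sub>M i\<in>J. measure_pmf Q) \<rightarrow>\<^sub>M iid Q" for J
    unfolding iid_def ext_def
  proof (rule measurable_abs_UNIV)
    fix n
    show "(\<lambda>\<omega>. if n \<in> J then \<omega> n else d) \<in> (\<Pi>\<^sub>M i\<in>J. measure_pmf Q) \<rightarrow>\<^sub>M measure_pmf Q"
      by (cases "n \<in> J") auto
  qed
  have comp: "distr (iid Q) (measure_pmf Q) (\<lambda>e. e i) = measure_pmf Q" for i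
    unfolding iid_def by (rule pr.PiM_component) simp
  have "indep_vars (\<lambda>_. measure_pmf Q) (\<lambda>i e. e i) (UNIV :: int set)"
  proof (subst indep_vars_iff_distr_eq_PiM)
    show "random_variable (measure_pmf Q) (\<lambda>e. e i)" for i
      unfolding iid_def by simp
    show "distr (iid Q) (\<Pi>\<^sub>M i\<in>UNIV. measure_pmf Q) (\<lambda>x. \<lambda>i\<in>UNIV. x i) =
        (\<Pi>\<^sub>M i\<in>UNIV. distr (iid Q) (measure_pmf Q) (\<lambda>x. x i))"
      unfolding comp by (simp add: restrict_UNIV iid_def distr_id2)
  qed simp
  from indep_var_restrict[OF this disj]
  have "indep_var (\<Pi>\<^sub>M i\<in>A. measure_pmf Q) (\<lambda>e. restrict e A) (\<Pi>\<^sub>M i\<in>B. measure_pmf Q) (\<lambda>e. restrict e B)"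
    by simp
  from indep_var_compose[OF this measurable_compose[OF ext f(1)] measurable_compose[OF ext g(1)]]
  have "indep_var borel ((\<lambda>r. f (ext A r)) \<circ> (\<lambda>e. restrict e A)) borel ((\<lambda>r. g (ext B r)) \<circ> (\<lambda>e. restrict e B))"
    by simp
  moreover have "(\<lambda>r. f (ext A r)) \<circ> (\<lambda>e. restrict e A) = f" "(\<lambda>r. g (ext B r)) \<circ> (\<lambda>e. restrict e B) = g"
    by (auto simp: fun_eq_iff ext_def intro!: loc)
  ultimately have "indep_var borel f borel g" by simp
  then show ?thesis
    using f g by (intro indep_var_lebesgue_integral integrable_const_bound[where B = 1]) auto
qed

text \<open>
  Only the pairs \<open>(i, j)\<close> for which the translates of \<open>J\<close> by \<open>i\<close> and \<open>j\<close> intersect contribute to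
  the variance; for each \<open>i\<close> there are at most as many \<open>j\<close> as there are differences of elements of \<open>J\<close>.
\<close>

lemma iid_average_variance:
  fixes h :: "nat \<Rightarrow> (int \<Rightarrow> 'e) \<Rightarrow> real"
  assumes h: "\<And>i. h i \<in> borel_measurable (iid Q)" "\<And>i e. 0 \<le> h i e" "\<And>i e. h i e \<le> 1"
    and loc: "\<And>i e e'. (\<forall>k\<in>J. e (k + int i) = e' (k + int i)) \<Longrightarrow> h i e = h i e'"
    and J: "finite J"
  shows "(\<integral>e. ((\<Sum>i<n. h i e) / real n - (\<Sum>i<n. \<integral>e. h i e \<partial>iid Q) / real n)\<^sup>2 \<partial>iid Q)
    \<le> real (card J ^ 2) / real n"
proof (cases "n = 0")
  case False
  interpret prob_space "iid Q" by (rule prob_space_iid)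
  define g where "g i e = h i e - (\<integral>e. h i e \<partial>iid Q)" for i e
  have ih: "integrable (iid Q) (h i)" for i
    using h by (intro integrable_const_bound[where B = 1]) auto
  have mg: "g i \<in> borel_measurable (iid Q)" for i
    unfolding g_def using h(1) by auto
  have Eh: "0 \<le> (\<integral>e. h i e \<partial>iid Q)" "(\<integral>e. h i e \<partial>iid Q) \<le> 1" for i
    using h ih by (auto intro!: integral_nonneg_AE integral_le_const)
  have g1: "\<bar>g i e\<bar> \<le> 1" for i e
    using h(2)[of i e] h(3)[of i e] Eh[of i] unfolding g_def by linarith
  have Eg: "(\<integral>e. g i e \<partial>iid Q) = 0" for i
    unfolding g_def using ih by simp
  have gg1: "\<bar>g i e * g j e\<bar> \<le> 1" for i j e
    unfolding abs_mult by (rule mult_le_one) (auto simp: g1)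
  have igg: "integrable (iid Q) (\<lambda>e. g i e * g j e)" for i j
    by (rule integrable_const_bound[where B = 1]) (use mg gg1 in auto)
  define D where "D = (\<lambda>(a, b). a - b) ` (J \<times> J)"
  have D: "finite D" "card D \<le> card J ^ 2"
    using J card_image_le[of "J \<times> J" "\<lambda>(a, b). a - b"]
    by (auto simp: D_def card_cartesian_product power2_eq_square)
  have cov: "(\<integral>e. g i e * g j e \<partial>iid Q) \<le> (if int i - int j \<in> D then 1 else 0)" for i j
  proof (cases "int i - int j \<in> D")
    case True
    then show ?thesis using igg gg1 by (auto intro!: integral_le_const simp: abs_le_iff)
  next
    case False
    have "(\<integral>e. g i e * g j e \<partial>iid Q) = (\<integral>e. g i e \<partial>iid Q) * (\<integral>e. g j e \<partial>iid Q)"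
    proof (rule iid_integral_mult_disjoint[where A = "(\<lambda>k. k + int i) ` J" and B = "(\<lambda>k. k + int j) ` J"])
      show "g i e = g i e'" if "\<forall>k\<in>(\<lambda>k. k + int i) ` J. e k = e' k" for i e e'
        using loc[of e i e'] that unfolding g_def by simp
      then show "g j e = g j e'" if "\<forall>k\<in>(\<lambda>k. k + int j) ` J. e k = e' k" for e e'
        using that by blast
      show "(\<lambda>k. k + int i) ` J \<inter> (\<lambda>k. k + int j) ` J = {}"
      proof (rule ccontr)
        assume "\<not> ?thesis"
        then obtain a b where "a \<in> J" "b \<in> J" "a + int i = b + int j" by auto
        then have "int i - int j = b - a" "(b, a) \<in> J \<times> J" by auto
        then have "int i - int j \<in> D" unfolding D_def by (metis case_prod_conv image_eqI)
        then show False using False by blast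
      qed
    qed (use mg g1 in auto)
    then show ?thesis using False Eg by simp
  qed
  have row: "(\<Sum>j<n. if int i - int j \<in> D then 1 else 0 :: real) \<le> real (card J ^ 2)" for i
  proof -
    have "(\<Sum>j<n. if int i - int j \<in> D then 1 else 0 :: real) = real (card {j \<in> {..<n}. int i - int j \<in> D})"
      by (simp add: sum.If_cases Int_def conj_commute)
    also have "card {j \<in> {..<n}. int i - int j \<in> D} \<le> card D"
      by (rule card_inj_on_le[where f = "\<lambda>j. int i - int j"]) (auto simp: inj_on_def D)
    finally show ?thesis using D(2) by linarith
  qed
  have "((\<Sum>i<n. h i e) / real n - (\<Sum>i<n. \<integral>e. h i e \<partial>iid Q) / real n)\<^sup>2 =
      (\<Sum>i<n. \<Sum>j<n. g i e * g j e) / (real n)\<^sup>2" for e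
    unfolding g_def by (simp add: sum_subtractf diff_divide_distrib[symmetric] power_divide
        sum_product[symmetric] power2_eq_square)
  then have "(\<integral>e. ((\<Sum>i<n. h i e) / real n - (\<Sum>i<n. \<integral>e. h i e \<partial>iid Q) / real n)\<^sup>2 \<partial>iid Q) =
      (\<Sum>i<n. \<Sum>j<n. \<integral>e. g i e * g j e \<partial>iid Q) / (real n)\<^sup>2"
    using igg by (simp add: Bochner_Integration.integral_sum integrable_sum)
  also have "\<dots> \<le> (\<Sum>i<n. real (card J ^ 2)) / (real n)\<^sup>2"
    by (intro divide_right_mono sum_mono order_trans[OF sum_mono[OF cov] row]) simp
  also have "\<dots> = real (card J ^ 2) / real n"
    using False by (simp add: power2_eq_square)
  finally show ?thesis .
qed simp

section \<open>Random codes of finite range\<close>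

text \<open>
  The symbol at \<open>0\<close> is decided by \<open>\<phi>\<close> from \<open>x\<close> and the marks \<open>e\<close> near \<open>0\<close>. Measurability in the marks is
  assumed for each \<open>x\<close> separately, as the type of marks may be uncountable; joint measurability follows, since
  only finitely many words on \<open>J\<close> exist.
\<close>

locale finite_range_code =
  fixes X :: "(int \<Rightarrow> bool) set" and \<nu> :: "(int \<Rightarrow> bool) measure" and Q :: "'e pmf"
    and J :: "int set" and \<phi> :: "(int \<Rightarrow> bool) \<Rightarrow> (int \<Rightarrow> 'e) \<Rightarrow> bool"
  assumes subshift: "subshift X" and unique: "uniquely_ergodic shift X"
    and \<nu>: "\<nu> \<in> invariant_measures shift X"
    and finite_J: "finite J"
    and local_code: "(\<And>i. i \<in> J \<Longrightarrow> x i = x' i) \<Longrightarrow> (\<And>i. i \<in> J \<Longrightarrow> e i = e' i) \<Longrightarrow> \<phi> x e = \<phi> x' e'"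
    and measurable_code: "{e. \<phi> z e} \<in> sets (iid Q)"
begin

text \<open>
  The conjunction with \<open>x j\<close> forces the coded point below \<open>x\<close>, whatever \<open>\<phi>\<close> is.
\<close>

definition code :: "(int \<Rightarrow> bool) \<Rightarrow> (int \<Rightarrow> 'e) \<Rightarrow> (int \<Rightarrow> bool)" where
  "code x e = (\<lambda>j. x j \<and> \<phi> (translate j x) (translate j e))"

definition source :: "((int \<Rightarrow> bool) \<times> (int \<Rightarrow> 'e)) measure" where
  "source = \<nu> \<Otimes>\<^sub>M iid Q"

definition code_measure :: "(int \<Rightarrow> bool) measure" where
  "code_measure = distr source (restrict_space borel (hereditary_closure X)) (\<lambda>(x, e). code x e)"

lemmas \<nu>D = invariant_measuresD[OF \<nu>]

sublocale N: prob_space \<nu> by (rule \<nu>D)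
sublocale I: prob_space "iid Q" by (rule prob_space_iid)
sublocale S: pair_prob_space \<nu> "iid Q" ..

lemma space_source: "space source = X \<times> UNIV"
  by (simp add: source_def space_pair_measure \<nu>D(5))

lemma prob_space_source: "prob_space source"
  unfolding source_def by (rule S.prob_space_axioms)

lemma code_translate: "code (translate i x) (translate i e) = translate i (code x e)"
  by (simp add: code_def translate_def add.assoc add.commute[of i])

lemma code_in_closure: "x \<in> X \<Longrightarrow> code x e \<in> hereditary_closure X"
  unfolding hereditary_closure_def code_def le_fun_def by auto

lemma sets_code_section: "{e. trunc (window m) (code z e) \<in> B} \<in> sets (iid Q)"
proof -
  have one: "{e. code z e j = b} \<in> sets (iid Q)" for j b
  proof -
    have "{e. \<phi> (translate j z) (translate j e)} = translate j -` {e. \<phi> (translate j z) e} \<inter> space (iid Q)"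
      by auto
    then have *: "{e. \<phi> (translate j z) (translate j e)} \<in> sets (iid Q)"
      using measurable_sets[OF measurable_translate measurable_code] by simp
    moreover have "{e. \<not> \<phi> (translate j z) (translate j e)} = space (iid Q) - {e. \<phi> (translate j z) (translate j e)}"
      by auto
    then have "{e. \<not> \<phi> (translate j z) (translate j e)} \<in> sets (iid Q)" using * by (metis sets.compl_sets)
    moreover have "UNIV \<in> sets (iid Q)" using sets.top[of "iid Q"] by simp
    ultimately show ?thesis unfolding code_def by (cases "z j"; cases b) auto
  qed
  have "{e. trunc (window m) (code z e) \<in> B} =
      (\<Union>w\<in>range (trunc (window m)) \<inter> B. {e. trunc (window m) (code z e) = w})" by auto
  also have "\<dots> \<in> sets (iid Q)"
  proof (intro sets.finite_UN)
    show "finite (range (trunc (window m)) \<inter> B)" by (simp add: finite_range_trunc)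
    fix w assume "w \<in> range (trunc (window m)) \<inter> B"
    then obtain y where w: "w = trunc (window m) y" by auto
    have "{e. trunc (window m) (code z e) = w} = (\<Inter>j\<in>window m. {e. code z e j = y j})"
      by (auto simp: w trunc_eq_iff)
    also have "\<dots> \<in> sets (iid Q)"
      by (rule sets.finite_INT) (use one in \<open>auto simp: window_def\<close>)
    finally show "{e. trunc (window m) (code z e) = w} \<in> sets (iid Q)" .
  qed
  finally show ?thesis .
qed

text \<open>
  All coordinates that can influence the symbols of the coded point in \<open>window m\<close>.
\<close>

definition coding_range :: "nat \<Rightarrow> int set" where
  "coding_range m = window m \<union> (\<lambda>(i, j). i + j) ` (J \<times> window m)"

lemma finite_coding_range: "finite (coding_range m)"
  unfolding coding_range_def using finite_J by simp

lemma code_local: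
  assumes "\<And>i. i \<in> coding_range m \<Longrightarrow> x i = x' i" "\<And>i. i \<in> coding_range m \<Longrightarrow> e i = e' i"
  shows "trunc (window m) (code x e) = trunc (window m) (code x' e')"
  unfolding trunc_eq_iff
proof
  fix j assume j: "j \<in> window m"
  have "i + j \<in> coding_range m" if "i \<in> J" for i
    using that j unfolding coding_range_def by force
  then have "\<phi> (translate j x) (translate j e) = \<phi> (translate j x') (translate j e')"
    by (intro local_code) (auto simp: translate_def assms)
  moreover have "x j = x' j" using j by (intro assms) (auto simp: coding_range_def)
  ultimately show "code x e j = code x' e' j" by (simp add: code_def)
qed

lemma sets_code_vimage:
  "{p \<in> space source. trunc (window m) (code (fst p) (snd p)) \<in> B} \<in> sets source"
proof -
  let ?r = "trunc (coding_range m)"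
  have r: "trunc (window m) (code x e) = trunc (window m) (code (?r x) e)" for x e
    by (rule code_local) (auto simp: trunc_def)
  have "{p \<in> space source. trunc (window m) (code (fst p) (snd p)) \<in> B} =
      (\<Union>z\<in>range ?r. (?r -` {z} \<inter> X) \<times> {e. trunc (window m) (code z e) \<in> B})"
  proof (rule set_eqI)
    fix p :: "(int \<Rightarrow> bool) \<times> (int \<Rightarrow> 'e)"
    obtain x e where p: "p = (x, e)" by (cases p)
    have "p \<in> {p \<in> space source. trunc (window m) (code (fst p) (snd p)) \<in> B} \<longleftrightarrow>
        x \<in> X \<and> trunc (window m) (code (?r x) e) \<in> B"
      unfolding p r[of x e, symmetric] by (simp add: space_source)
    also have "\<dots> \<longleftrightarrow> p \<in> (\<Union>z\<in>range ?r. (?r -` {z} \<inter> X) \<times> {e. trunc (window m) (code z e) \<in> B})"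
      unfolding p by auto
    finally show "p \<in> {p \<in> space source. trunc (window m) (code (fst p) (snd p)) \<in> B} \<longleftrightarrow>
        p \<in> (\<Union>z\<in>range ?r. (?r -` {z} \<inter> X) \<times> {e. trunc (window m) (code z e) \<in> B})" .
  qed
  also have "\<dots> \<in> sets source"
    unfolding source_def
    by (intro sets.finite_UN finite_range_trunc finite_coding_range pair_measureI
        sets_borel_restrictD(4)[OF \<nu>D(2)] sets_code_section)
  finally show ?thesis .
qed

lemma measurable_code_map:
  "(\<lambda>(x, e). code x e) \<in> source \<rightarrow>\<^sub>M restrict_space borel (hereditary_closure X)"
proof (rule measurable_restrict_space2)
  show "(\<lambda>(x, e). code x e) \<in> space source \<rightarrow> hereditary_closure X"
    by (auto simp: space_source code_in_closure)
  show "(\<lambda>(x, e). code x e) \<in> source \<rightarrow>\<^sub>M borel"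
  proof (rule measurable_sigma_sets[OF sets_borel_cylinders])
    fix C :: "(int \<Rightarrow> bool) set" assume "C \<in> cylinders"
    then obtain m B where "C = trunc (window m) -` B" unfolding cylinders_def by blast
    then have "(\<lambda>(x, e). code x e) -` C \<inter> space source =
        {p \<in> space source. trunc (window m) (code (fst p) (snd p)) \<in> B}" by auto
    then show "(\<lambda>(x, e). code x e) -` C \<inter> space source \<in> sets source" using sets_code_vimage by simp
  qed auto
qed

lemma translate_source:
  "(\<lambda>(x, e). (shift x, translate 1 e)) \<in> source \<rightarrow>\<^sub>M source"
  "distr source source (\<lambda>(x, e). (shift x, translate 1 e)) = source"
proof -
  show "(\<lambda>(x, e). (shift x, translate 1 e)) \<in> source \<rightarrow>\<^sub>M source"
    unfolding source_def using measurable_translate \<nu>D(3) by measurable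
  have "sigma_finite_measure (distr (iid Q) (iid Q) (translate 1))"
    unfolding distr_translate_iid ..
  from pair_measure_distr[OF \<nu>D(3) measurable_translate this]
  show "distr source source (\<lambda>(x, e). (shift x, translate 1 e)) = source"
    by (simp add: source_def distr_translate_iid \<nu>D(4))
qed

lemma sets_code_measure [simp]: "sets code_measure = sets (restrict_space borel (hereditary_closure X))"
  by (simp add: code_measure_def)

lemma code_measure_invariant: "code_measure \<in> invariant_measures shift (hereditary_closure X)"
  unfolding invariant_measures_def
proof (intro CollectI conjI)
  let ?Y = "restrict_space borel (hereditary_closure X)"
  have sh: "shift \<in> ?Y \<rightarrow>\<^sub>M ?Y"
    by (rule measurable_shift_restrict[OF subshift_hereditary_closure[OF subshift]])
  show "prob_space code_measure"
    unfolding code_measure_def by (rule prob_space.prob_space_distr[OF prob_space_source measurable_code_map])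
  show "sets code_measure = sets ?Y" by simp
  show "shift \<in> code_measure \<rightarrow>\<^sub>M code_measure"
    using sh by (simp add: measurable_cong_sets[OF sets_code_measure sets_code_measure])
  have "distr code_measure code_measure shift = distr code_measure ?Y shift"
    by (rule distr_cong) simp_all
  also have "\<dots> = distr source ?Y (shift \<circ> (\<lambda>(x, e). code x e))"
    unfolding code_measure_def by (rule distr_distr[OF sh measurable_code_map])
  also have "shift \<circ> (\<lambda>(x, e). code x e) = (\<lambda>(x, e). code x e) \<circ> (\<lambda>(x, e). (shift x, translate 1 e))"
  proof -
    have "shift x = translate 1 x" for x
      using fun_cong[OF shift_funpow_translate[of 1]] by simp
    then show ?thesis by (intro ext) (simp add: split_beta code_translate)
  qed
  also have "distr source ?Y \<dots> = distr (distr source source (\<lambda>(x, e). (shift x, translate 1 e))) ?Y (\<lambda>(x, e). code x e)"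
    by (rule distr_distr[symmetric, OF measurable_code_map translate_source(1)])
  also have "\<dots> = code_measure" by (simp add: translate_source(2) code_measure_def)
  finally show "distr code_measure code_measure shift = code_measure" .
qed

lemma measure_code_measure:
  "measure code_measure (trunc (window m) -` B \<inter> hereditary_closure X) =
    (\<integral>x. measure (iid Q) {e. trunc (window m) (code x e) \<in> B} \<partial>\<nu>)"
proof -
  let ?T = "{p \<in> space source. trunc (window m) (code (fst p) (snd p)) \<in> B}"
  have C: "trunc (window m) -` B \<in> cylinders" by (rule vimage_trunc_in_cylinders) simp
  have "measure code_measure (trunc (window m) -` B \<inter> hereditary_closure X) =
      measure source ((\<lambda>(x, e). code x e) -` (trunc (window m) -` B \<inter> hereditary_closure X) \<inter> space source)"
    unfolding code_measure_def
    by (rule measure_distr[OF measurable_code_map sets_borel_restrictD(2)[OF refl cylinders_borel[OF C]]])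
  also have "(\<lambda>(x, e). code x e) -` (trunc (window m) -` B \<inter> hereditary_closure X) \<inter> space source = ?T"
    by (auto simp: space_source code_in_closure)
  also have "measure source ?T = (\<integral>p. indicator ?T p \<partial>source)"
    by (simp add: Int_absorb2 Collect_restrict)
  also have "\<dots> = (\<integral>x. (\<integral>e. indicator ?T (x, e) \<partial>iid Q) \<partial>\<nu>)"
  proof -
    have "integrable source (indicator ?T :: _ \<Rightarrow> real)"
      using sets_code_vimage[of m B] prob_space_source
      by (intro finite_measure.integrable_const_bound[where B = 1]) (auto simp: prob_space_def)
    then show ?thesis unfolding source_def by (rule S.integral_fst'[symmetric])
  qed
  also have "\<dots> = (\<integral>x. measure (iid Q) {e. trunc (window m) (code x e) \<in> B} \<partial>\<nu>)"
  proof (rule Bochner_Integration.integral_cong[OF refl])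
    fix x assume "x \<in> space \<nu>"
    then have "(\<lambda>e. indicator ?T (x, e) :: real) = indicator {e. trunc (window m) (code x e) \<in> B}"
      by (auto simp: space_source \<nu>D(5) indicator_def fun_eq_iff)
    then show "(\<integral>e. indicator ?T (x, e) \<partial>iid Q) = measure (iid Q) {e. trunc (window m) (code x e) \<in> B}"
      by simp
  qed
  finally show ?thesis .
qed

lemma integrable_code_section:
  "integrable \<nu> (\<lambda>x. measure (iid Q) {e. trunc (window m) (code x e) \<in> B})"
proof -
  let ?r = "trunc (coding_range m)"
  have "trunc (window m) (code (?r x) e) = trunc (window m) (code x e)" for x e
    by (rule code_local) (auto simp: trunc_def)
  then show ?thesis
    using integral_cylinder_function(2)[OF \<nu>D(1,2) finite_coding_range[of m],
        where F = "\<lambda>x. measure (iid Q) {e. trunc (window m) (code x e) \<in> B}"] by simp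
qed

text \<open>
  For fixed \<open>x\<close> the mean square deviation from the constant \<open>c\<close> is the variance over the marks plus the
  squared deviation of the conditional mean \<open>a\<close> from \<open>c\<close>; the former is small by independence, the latter by
  unique ergodicity.
\<close>

lemma code_measure_variance:
  assumes C: "C \<in> cylinders" and e: "e > 0"
  shows "\<exists>n>0. (\<integral>y. (frequency n y C - measure code_measure (C \<inter> hereditary_closure X))\<^sup>2 \<partial>code_measure) < e"
proof -
  obtain m B where CB: "C = trunc (window m) -` B" using C unfolding cylinders_def by blast
  let ?r = "trunc (coding_range m)"
  define h :: "(int \<Rightarrow> bool) \<Rightarrow> (int \<Rightarrow> 'e) \<Rightarrow> real" where "h x e = indicator C (code x e)" for x e
  define F where "F x = (\<integral>e. h x e \<partial>iid Q)" for x
  have h_local: "h x e = h x' e'"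
    if "\<And>i. i \<in> coding_range m \<Longrightarrow> x i = x' i" "\<And>i. i \<in> coding_range m \<Longrightarrow> e i = e' i" for x x' e e'
    using code_local[OF that] unfolding h_def CB by (simp add: indicator_def)
  have F_local: "F x = F (?r x)" for x
    unfolding F_def by (intro Bochner_Integration.integral_cong refl h_local) (auto simp: trunc_def)
  have h01: "0 \<le> h x e" "h x e \<le> 1" for x e by (auto simp: h_def indicator_def)
  have h_meas: "h x \<in> borel_measurable (iid Q)" for x
  proof -
    have "h x = indicator {e. trunc (window m) (code x e) \<in> B}"
      by (auto simp: h_def CB indicator_def fun_eq_iff)
    then show ?thesis using sets_code_section by simp
  qed
  define c where "c = measure code_measure (C \<inter> hereditary_closure X)"
  have c: "c = (\<integral>x. F x \<partial>\<nu>)"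
  proof -
    have "F x = measure (iid Q) {e. trunc (window m) (code x e) \<in> B}" for x
    proof -
      have "h x = indicator {e. trunc (window m) (code x e) \<in> B}"
        by (auto simp: h_def CB indicator_def fun_eq_iff)
      then show ?thesis unfolding F_def by simp
    qed
    then show ?thesis unfolding c_def CB measure_code_measure by simp
  qed
  have EF: "(\<integral>e. h x (translate j e) \<partial>iid Q) = F x" for x j
    unfolding F_def using integral_distr[OF measurable_translate h_meas] by (simp add: distr_translate_iid)
  have "\<forall>\<^sub>F n in sequentially. \<forall>x\<in>X.
      \<bar>(\<Sum>i<n. F (?r ((shift ^^ i) x))) / real n - (\<integral>x. F (?r x) \<partial>\<nu>)\<bar> < sqrt (e / 2)"
    by (rule uniform_average[OF subshift unique \<nu> finite_coding_range]) (use e in simp)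
  moreover have "\<forall>\<^sub>F n in sequentially. real (card (coding_range m) ^ 2) / real n < e / 2"
    using order_tendstoD(2)[OF lim_const_over_n[of "real (card (coding_range m) ^ 2)"], of "e / 2"] e by simp
  moreover have "\<forall>\<^sub>F n in sequentially. n > (0::nat)" by (rule eventually_gt_at_top)
  ultimately have "\<forall>\<^sub>F n in sequentially. n > 0 \<and> real (card (coding_range m) ^ 2) / real n < e / 2 \<and>
      (\<forall>x\<in>X. \<bar>(\<Sum>i<n. F ((shift ^^ i) x)) / real n - c\<bar> < sqrt (e / 2))"
    unfolding F_local[symmetric] c by eventually_elim blast
  then obtain n where n: "n > 0" "real (card (coding_range m) ^ 2) / real n < e / 2"
      "\<And>x. x \<in> X \<Longrightarrow> \<bar>(\<Sum>i<n. F ((shift ^^ i) x)) / real n - c\<bar> < sqrt (e / 2)"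
    unfolding eventually_sequentially by blast
  define A where "A x e = (\<Sum>i<n. h ((shift ^^ i) x) (translate (int i) e)) / real n" for x e
  have freq: "frequency n (code x e) C = A x e" for x e
    unfolding frequency_def A_def h_def shift_funpow_translate code_translate ..
  have A01: "0 \<le> A x e" "A x e \<le> 1" for x e
    unfolding freq[symmetric] by (rule frequency_bounds)+
  have c01: "0 \<le> c" "c \<le> 1"
    unfolding c_def using invariant_measuresD(1)[OF code_measure_invariant]
    by (auto intro: prob_space.prob_le_1)
  have Ac: "\<bar>A x e - c\<bar> \<le> 1" for x e using A01[of x e] c01 by linarith
  have Ac2: "(A x e - c)\<^sup>2 \<le> 1" for x e using Ac by (simp add: abs_square_le_1)
  have hi_meas: "(\<lambda>e. h x (translate j e)) \<in> borel_measurable (iid Q)" for x j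
    by (rule measurable_compose[OF measurable_translate h_meas])
  have A_meas: "A x \<in> borel_measurable (iid Q)" for x
    unfolding A_def using hi_meas by auto
  have EA: "(\<integral>e. A x e \<partial>iid Q) = (\<Sum>i<n. F ((shift ^^ i) x)) / real n" for x
  proof -
    have "integrable (iid Q) (\<lambda>e. h x (translate j e))" for x j
      using hi_meas h01 by (intro I.integrable_const_bound[where B = 1]) auto
    then show ?thesis
      unfolding A_def by (simp add: Bochner_Integration.integral_sum EF)
  qed
  have inner: "(\<integral>e. (A x e - c)\<^sup>2 \<partial>iid Q) \<le> real (card (coding_range m) ^ 2) / real n + e / 2" if x: "x \<in> X" for x
  proof -
    define a where "a = (\<Sum>i<n. F ((shift ^^ i) x)) / real n"
    have iA: "integrable (iid Q) (A x)"
      using A_meas A01 by (intro I.integrable_const_bound[where B = 1]) auto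
    have a01: "0 \<le> a" "a \<le> 1"
      unfolding a_def EA[symmetric] using A01 iA by (auto intro!: integral_nonneg_AE I.integral_le_const)
    have "\<bar>A x e - a\<bar> \<le> 1" for e using A01[of x e] a01 by linarith
    then have "(A x e - a)\<^sup>2 \<le> 1" for e by (simp add: abs_square_le_1)
    then have iA2: "integrable (iid Q) (\<lambda>e. (A x e - a)\<^sup>2)"
      using A_meas by (intro I.integrable_const_bound[where B = 1]) auto
    have "(\<integral>e. (A x e - c)\<^sup>2 \<partial>iid Q) = (\<integral>e. (A x e - a)\<^sup>2 + 2 * (a - c) * (A x e - a) + (a - c)\<^sup>2 \<partial>iid Q)"
      by (rule Bochner_Integration.integral_cong) (auto simp: power2_eq_square algebra_simps)
    also have "\<dots> = (\<integral>e. (A x e - a)\<^sup>2 \<partial>iid Q) + (a - c)\<^sup>2"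
      using iA iA2 by (simp add: EA a_def)
    also have "(a - c)\<^sup>2 \<le> e / 2"
    proof -
      have "\<bar>a - c\<bar> \<le> sqrt (e / 2)" using n(3)[OF x] unfolding a_def by simp
      then have "\<bar>a - c\<bar>\<^sup>2 \<le> (sqrt (e / 2))\<^sup>2" by (rule power_mono) simp
      then show ?thesis using e by simp
    qed
    also have "(\<integral>e. (A x e - a)\<^sup>2 \<partial>iid Q) \<le> real (card (coding_range m) ^ 2) / real n"
    proof -
      have "(\<integral>e. ((\<Sum>i<n. h ((shift ^^ i) x) (translate (int i) e)) / real n -
          (\<Sum>i<n. \<integral>e. h ((shift ^^ i) x) (translate (int i) e) \<partial>iid Q) / real n)\<^sup>2 \<partial>iid Q)
          \<le> real (card (coding_range m) ^ 2) / real n"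
      proof (rule iid_average_variance[where J = "coding_range m"])
        show "h ((shift ^^ i) x) (translate (int i) e) = h ((shift ^^ i) x) (translate (int i) e')"
          if "\<forall>k\<in>coding_range m. e (k + int i) = e' (k + int i)" for i e e'
          using that by (intro h_local) (auto simp: translate_def)
      qed (simp_all add: hi_meas h01 finite_coding_range)
      then show ?thesis by (simp add: EF A_def a_def)
    qed
    finally show ?thesis by simp
  qed
  have "(\<integral>y. (frequency n y C - c)\<^sup>2 \<partial>code_measure) = (\<integral>p. (A (fst p) (snd p) - c)\<^sup>2 \<partial>source)"
  proof -
    have "(\<lambda>y. (frequency n y C - c)\<^sup>2) \<in> borel_measurable (restrict_space borel (hereditary_closure X))"
      by (intro measurable_restrict_space1 borel_measurable_power borel_measurable_diff measurable_frequency C) auto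
    from integral_distr[OF measurable_code_map this] show ?thesis
      unfolding code_measure_def by (simp add: freq split_beta)
  qed
  moreover have "(\<integral>p. (A (fst p) (snd p) - c)\<^sup>2 \<partial>source) = (\<integral>x. (\<integral>e. (A x e - c)\<^sup>2 \<partial>iid Q) \<partial>\<nu>)"
    and int\<nu>: "integrable \<nu> (\<lambda>x. \<integral>e. (A x e - c)\<^sup>2 \<partial>iid Q)"
  proof -
    have "(\<lambda>y. (frequency n y C - c)\<^sup>2) \<in> borel_measurable (restrict_space borel (hereditary_closure X))"
      by (intro measurable_restrict_space1 borel_measurable_power borel_measurable_diff measurable_frequency C) auto
    from measurable_compose[OF measurable_code_map this]
    have "(\<lambda>p. (A (fst p) (snd p) - c)\<^sup>2) \<in> borel_measurable source"
      by (simp add: freq split_beta)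
    then have "integrable source (\<lambda>p. (A (fst p) (snd p) - c)\<^sup>2)"
      using prob_space_source Ac2
      by (intro finite_measure.integrable_const_bound[where B = 1]) (auto simp: prob_space_def)
    then have int: "integrable (\<nu> \<Otimes>\<^sub>M iid Q) (\<lambda>p. (A (fst p) (snd p) - c)\<^sup>2)" by (simp add: source_def)
    show "(\<integral>p. (A (fst p) (snd p) - c)\<^sup>2 \<partial>source) = (\<integral>x. (\<integral>e. (A x e - c)\<^sup>2 \<partial>iid Q) \<partial>\<nu>)"
      unfolding source_def using S.integral_fst'[OF int] by simp
    show "integrable \<nu> (\<lambda>x. \<integral>e. (A x e - c)\<^sup>2 \<partial>iid Q)"
      using S.integrable_fst'[OF int] by simp
  qed
  moreover have "(\<integral>x. (\<integral>e. (A x e - c)\<^sup>2 \<partial>iid Q) \<partial>\<nu>) \<le> real (card (coding_range m) ^ 2) / real n + e / 2"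
    using inner int\<nu> by (intro N.integral_le_const AE_I2) (auto simp: \<nu>D(5))
  ultimately have "(\<integral>y. (frequency n y C - c)\<^sup>2 \<partial>code_measure) < e" using n(2) by linarith
  then show ?thesis unfolding c_def using n(1) by (intro exI[of _ n] conjI)
qed

lemma code_measure_extreme:
  "code_measure \<in> extreme_measures (invariant_measures shift (hereditary_closure X))"
  by (rule extreme_measureI[OF subshift_hereditary_closure[OF subshift] code_measure_invariant code_measure_variance])

end

section \<open>A kernel from blocks of X to blocks of its hereditary closure\<close>

lemma measure_bind_pmf:
  "measure_pmf.prob (bind_pmf M N) B = (\<integral>x. measure_pmf.prob (N x) B \<partial>measure_pmf M)"
proof -
  have "ennreal (measure_pmf.prob (bind_pmf M N) B) = (\<integral>\<^sup>+x. ennreal (measure_pmf.prob (N x) B) \<partial>measure_pmf M)"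
    using emeasure_bind_pmf[of M N B] by (simp add: measure_pmf.emeasure_eq_measure)
  also have "\<dots> = ennreal (\<integral>x. measure_pmf.prob (N x) B \<partial>measure_pmf M)"
    by (intro nn_integral_eq_integral measure_pmf.integrable_const_bound[where B = 1]) auto
  finally show ?thesis
    by (subst (asm) ennreal_inj) (auto intro!: integral_nonneg_AE)
qed

text \<open>
  Conditional laws for a discrete joint law. For \<open>w\<close> outside the support of the first marginal the default
  \<open>d w\<close> is chosen, so that a relation holding on the support and between each \<open>w\<close> and \<open>d w\<close> holds almost surely
  for the kernel.
\<close>

lemma pmf_disintegration:
  fixes \<eta> :: "('a \<times> 'b) pmf"
  obtains G :: "'a \<Rightarrow> 'b pmf" where
    "\<And>w v. v \<in> set_pmf (G w) \<Longrightarrow> (w, v) \<in> set_pmf \<eta> \<or> v = d w"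
    "\<And>w B. measure_pmf.prob \<eta> {p. fst p = w} * measure_pmf.prob (G w) B =
      measure_pmf.prob \<eta> {p. fst p = w \<and> snd p \<in> B}"
proof -
  define F where "F w = {p :: 'a \<times> 'b. fst p = w}" for w
  define G where "G w = (if set_pmf \<eta> \<inter> F w = {} then return_pmf (d w)
    else map_pmf snd (cond_pmf \<eta> (F w)))" for w
  show ?thesis
  proof (rule that[of G])
    show "(w, v) \<in> set_pmf \<eta> \<or> v = d w" if "v \<in> set_pmf (G w)" for w v
      using that by (auto simp: G_def F_def set_cond_pmf split: if_splits)
    show "measure_pmf.prob \<eta> {p. fst p = w} * measure_pmf.prob (G w) B =
      measure_pmf.prob \<eta> {p. fst p = w \<and> snd p \<in> B}" for w B
    proof (cases "set_pmf \<eta> \<inter> F w = {}")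
      case True
      then have "measure_pmf.prob \<eta> (F w) = 0" by (simp add: measure_pmf_zero_iff)
      moreover have "measure_pmf.prob \<eta> {p. fst p = w \<and> snd p \<in> B} \<le> measure_pmf.prob \<eta> (F w)"
        by (rule measure_pmf.finite_measure_mono) (auto simp: F_def)
      ultimately show ?thesis
        using measure_nonneg[of "measure_pmf \<eta>" "{p. fst p = w \<and> snd p \<in> B}"] by (simp add: F_def)
    next
      case False
      have pos: "measure_pmf.prob \<eta> (F w) \<noteq> 0" using False by (simp add: measure_pmf_zero_iff)
      have "measure_pmf.prob (cond_pmf \<eta> (F w)) (snd -` B) =
          measure_pmf.prob \<eta> (F w \<inter> snd -` B) / measure_pmf.prob \<eta> (F w)"
        using False pos by (subst cond_pmf.rep_eq)
          (simp_all add: measure_uniform_measure measure_pmf.emeasure_eq_measure)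
      moreover have "G w = map_pmf snd (cond_pmf \<eta> (F w))" using False by (simp add: G_def)
      moreover have "F w \<inter> snd -` B = {p. fst p = w \<and> snd p \<in> B}" by (auto simp: F_def)
      ultimately show ?thesis
        using pos by (simp add: F_def)
    qed
  qed
qed

lemma pmf_of_cylinder_law:
  assumes D: "prob_space \<mu>" "sets \<mu> = sets (restrict_space borel Y)" and K: "finite K"
  obtains \<kappa> :: "(int \<Rightarrow> bool) pmf" where
    "measure_pmf \<kappa> = distr \<mu> (count_space UNIV) (trunc K)" "set_pmf \<kappa> \<subseteq> trunc K ` Y"
proof -
  interpret prob_space \<mu> by fact
  let ?D = "distr \<mu> (count_space UNIV) (trunc K)"
  have m: "trunc K \<in> \<mu> \<rightarrow>\<^sub>M count_space UNIV" by (rule sets_borel_restrictD(3)[OF D(2) K])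
  interpret d: prob_space ?D by (rule prob_space_distr[OF m])
  have "AE z in ?D. measure ?D {z} \<noteq> 0"
  proof (rule AE_I)
    show "{z \<in> space ?D. \<not> measure ?D {z} \<noteq> 0} \<subseteq>
        (\<Union>z\<in>{z \<in> range (trunc K). measure ?D {z} = 0}. {z}) \<union> - range (trunc K)" by auto
    have "(\<Union>z\<in>{z \<in> range (trunc K). measure ?D {z} = 0}. {z}) \<in> null_sets ?D"
      by (rule null_sets_UN')
         (auto intro!: countable_finite finite_range_trunc K simp: null_sets_def d.emeasure_eq_measure)
    moreover have "- range (trunc K) \<in> null_sets ?D"
    proof -
      have "trunc K -` (- range (trunc K)) = {}" by auto
      then show ?thesis by (simp add: null_sets_def emeasure_distr[OF m])
    qed
    ultimately have *: "(\<Union>z\<in>{z \<in> range (trunc K). measure ?D {z} = 0}. {z}) \<union> - range (trunc K) \<in> null_sets ?D"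
      by (rule null_sets.Un)
    show "emeasure ?D ((\<Union>z\<in>{z \<in> range (trunc K). measure ?D {z} = 0}. {z}) \<union> - range (trunc K)) = 0"
      using * by (rule null_setsD1)
    show "(\<Union>z\<in>{z \<in> range (trunc K). measure ?D {z} = 0}. {z}) \<union> - range (trunc K) \<in> sets ?D" by simp
  qed
  then have eq: "measure_pmf (Abs_pmf ?D) = ?D"
    by (intro Abs_pmf_inverse) (simp add: d.prob_space_axioms)
  show ?thesis
  proof (rule that[OF eq])
    show "set_pmf (Abs_pmf ?D) \<subseteq> trunc K ` Y"
    proof
      fix z assume "z \<in> set_pmf (Abs_pmf ?D)"
      then have "measure ?D {z} \<noteq> 0" by (simp add: set_pmf.rep_eq eq)
      then have "measure \<mu> (trunc K -` {z} \<inter> space \<mu>) \<noteq> 0" by (simp add: measure_distr[OF m])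
      then have "trunc K -` {z} \<inter> space \<mu> \<noteq> {}" by (metis measure_empty)
      then show "z \<in> trunc K ` Y" using sets_borel_restrictD(1)[OF D(2)] by auto
    qed
  qed
qed

text \<open>
  The joint law \<open>\<eta>\<close> is that of two blocks read at the same random place: one in a point \<open>z\<close> distributed like the
  restriction of \<open>\<mu>\<close> to finitely many coordinates, and one in a point \<open>sel z\<close> of \<open>X\<close> above \<open>z\<close>. This restriction leaves finitely many choices, so that no measurable selection is involved. The
  second marginal is that of \<open>\<mu>\<close> by invariance, the first one is within \<open>d / card R\<close> of that of \<open>\<nu>\<close> for each word
  by unique ergodicity.
\<close>

lemma block_kernel:
  assumes X: "subshift X" and ue: "uniquely_ergodic shift X" and \<nu>: "\<nu> \<in> invariant_measures shift X"
    and \<mu>: "\<mu> \<in> invariant_measures shift (hereditary_closure X)" and J: "finite J" and d: "d > 0"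
  obtains G :: "(int \<Rightarrow> bool) \<Rightarrow> (int \<Rightarrow> bool) pmf" where
    "\<And>w v. v \<in> set_pmf (G w) \<Longrightarrow> v \<le> w"
    "\<And>B. \<bar>(\<integral>x. measure_pmf.prob (G (trunc J x)) B \<partial>\<nu>) -
      measure \<mu> (trunc J -` B \<inter> hereditary_closure X)\<bar> \<le> d"
proof -
  let ?Y = "hereditary_closure X"
  note D = invariant_measuresD[OF \<nu>] and DM = invariant_measuresD[OF \<mu>]
  have Y: "subshift ?Y" by (rule subshift_hereditary_closure[OF X])
  define R where "R = range (trunc J)"
  have R: "finite R" unfolding R_def by (rule finite_range_trunc[OF J])
  have cR: "card R > 0" using R by (auto simp: card_gt_0_iff R_def)
  have cyl: "trunc J -` B \<in> cylinders" for B by (rule vimage_trunc_in_cylinders[OF J])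
  have "\<forall>\<^sub>F n in sequentially. n > 0 \<and> (\<forall>w\<in>R. \<forall>x\<in>X.
      \<bar>frequency n x (trunc J -` {w}) - measure \<nu> (trunc J -` {w} \<inter> X)\<bar> < d / card R)"
    using d cR by (intro eventually_conj eventually_gt_at_top eventually_ball_finite R ballI
        uniform_frequency[OF X ue \<nu>] cyl) auto
  then obtain n where n: "n > 0" "\<And>w x. w \<in> R \<Longrightarrow> x \<in> X \<Longrightarrow>
      \<bar>frequency n x (trunc J -` {w}) - measure \<nu> (trunc J -` {w} \<inter> X)\<bar> < d / card R"
    unfolding eventually_sequentially by blast
  define K where "K = (\<Union>i<n. (\<lambda>k. k + int i) ` J)"
  have K: "finite K" unfolding K_def using J by simp
  obtain \<kappa> where \<kappa>: "measure_pmf \<kappa> = distr \<mu> (count_space UNIV) (trunc K)" "set_pmf \<kappa> \<subseteq> trunc K ` ?Y"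
    by (rule pmf_of_cylinder_law[OF DM(1,2) K])
  define sel where "sel z = (SOME x. x \<in> X \<and> z \<le> x)" for z
  have sel: "sel z \<in> X \<and> z \<le> sel z" if "z \<in> set_pmf \<kappa>" for z
  proof -
    from that obtain y x where "z = trunc K y" "y \<le> x" "x \<in> X"
      using \<kappa>(2) unfolding hereditary_closure_def by blast
    then have "x \<in> X \<and> z \<le> x" using order_trans[OF trunc_le] by blast
    then show ?thesis unfolding sel_def by (rule someI[where P = "\<lambda>x. x \<in> X \<and> z \<le> x"])
  qed
  define \<eta> where "\<eta> = bind_pmf \<kappa> (\<lambda>z. map_pmf (\<lambda>i. (trunc J ((shift ^^ i) (sel z)), trunc J ((shift ^^ i) z)))
      (pmf_of_set {..<n}))"
  have ne: "{..<n} \<noteq> {}" using n(1) by auto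
  have prob_\<eta>: "measure_pmf.prob \<eta> S = (\<integral>z. (\<Sum>i<n. indicator S (trunc J ((shift ^^ i) (sel z)), trunc J ((shift ^^ i) z))) / real n \<partial>measure_pmf \<kappa>)"
    for S
    unfolding \<eta>_def measure_bind_pmf measure_map_pmf
    by (intro Bochner_Integration.integral_cong refl, subst measure_pmf_of_set[OF ne])
       (auto simp: indicator_def sum.If_cases Int_def vimage_def)
  obtain G where G: "\<And>w v. v \<in> set_pmf (G w) \<Longrightarrow> (w, v) \<in> set_pmf \<eta> \<or> v = w"
    "\<And>w B. measure_pmf.prob \<eta> {p. fst p = w} * measure_pmf.prob (G w) B =
      measure_pmf.prob \<eta> {p. fst p = w \<and> snd p \<in> B}"
    using pmf_disintegration[of \<eta> "\<lambda>w. w"] by blast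
  show ?thesis
  proof (rule that[of G])
    show "v \<le> w" if "v \<in> set_pmf (G w)" for w v
    proof -
      have "v \<le> w" if "(w, v) \<in> set_pmf \<eta>"
      proof -
        obtain z i where z: "z \<in> set_pmf \<kappa>" "w = trunc J ((shift ^^ i) (sel z))" "v = trunc J ((shift ^^ i) z)"
          using \<open>(w, v) \<in> set_pmf \<eta>\<close> ne unfolding \<eta>_def by auto
        then have "(shift ^^ i) z \<le> (shift ^^ i) (sel z)"
          using sel[OF z(1)] by (auto simp: shift_funpow le_fun_def)
        then show ?thesis using z trunc_mono by blast
      qed
      then show ?thesis using G(1)[OF that] by auto
    qed
    fix B
    let ?a = "\<lambda>w. measure_pmf.prob \<eta> {p. fst p = w}" and ?b = "\<lambda>w. measure \<nu> (trunc J -` {w} \<inter> X)"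
      and ?g = "\<lambda>w. measure_pmf.prob (G w) B"
    have a: "\<bar>?a w - ?b w\<bar> \<le> d / card R" if w: "w \<in> R" for w
    proof -
      have bd: "AE z in measure_pmf \<kappa>. \<bar>frequency n (sel z) (trunc J -` {w}) - ?b w\<bar> \<le> d / card R"
        using n(2)[OF w] sel by (auto simp: AE_measure_pmf_iff intro!: less_imp_le)
      have int: "integrable (measure_pmf \<kappa>) (\<lambda>z. frequency n (sel z) (trunc J -` {w}))"
        by (intro measure_pmf.integrable_const_bound[where B = 1]) (auto simp: frequency_bounds)
      have "?a w = (\<integral>z. frequency n (sel z) (trunc J -` {w}) \<partial>measure_pmf \<kappa>)"
        unfolding prob_\<eta> frequency_def by (simp add: indicator_def)
      then have "?a w - ?b w = (\<integral>z. frequency n (sel z) (trunc J -` {w}) - ?b w \<partial>measure_pmf \<kappa>)"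
        using int by simp
      also have "\<bar>\<dots>\<bar> \<le> (\<integral>z. \<bar>frequency n (sel z) (trunc J -` {w}) - ?b w\<bar> \<partial>measure_pmf \<kappa>)"
        by (rule integral_abs_bound)
      also have "\<dots> \<le> d / card R"
        using int bd by (intro measure_pmf.integral_le_const) auto
      finally show ?thesis .
    qed
    have "(\<Sum>w\<in>R. ?a w * ?g w) = (\<Sum>w\<in>R. measure_pmf.prob \<eta> {p. fst p = w \<and> snd p \<in> B})"
      by (simp add: G(2))
    also have "\<dots> = measure_pmf.prob \<eta> (\<Union>w\<in>R. {p. fst p = w \<and> snd p \<in> B})"
      by (rule measure_pmf.finite_measure_finite_Union[symmetric])
         (auto simp: R disjoint_family_on_def)
    also have "\<dots> = (\<integral>z. frequency n z (trunc J -` B) \<partial>measure_pmf \<kappa>)"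
      unfolding prob_\<eta> frequency_def
      by (intro Bochner_Integration.integral_cong refl arg_cong2[where f = "(/)"] sum.cong)
         (auto simp: indicator_def R_def)
    also have "\<dots> = (\<integral>y. frequency n (trunc K y) (trunc J -` B) \<partial>\<mu>)"
      unfolding \<kappa>(1) by (rule integral_distr[OF sets_borel_restrictD(3)[OF DM(2) K]]) simp
    also have "\<dots> = (\<integral>y. frequency n y (trunc J -` B) \<partial>\<mu>)"
    proof (intro Bochner_Integration.integral_cong refl)
      fix y
      have "trunc J ((shift ^^ i) (trunc K y)) = trunc J ((shift ^^ i) y)" if "i < n" for i
        using that unfolding trunc_eq_iff shift_funpow K_def trunc_def by auto
      then show "frequency n (trunc K y) (trunc J -` B) = frequency n y (trunc J -` B)"
        unfolding frequency_def by (simp add: indicator_def)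
    qed
    also have "\<dots> = measure \<mu> (trunc J -` B \<inter> ?Y)"
      by (rule integral_frequency[OF \<mu> Y cyl n(1)])
    finally have snd: "(\<Sum>w\<in>R. ?a w * ?g w) = measure \<mu> (trunc J -` B \<inter> ?Y)" .
    have "(\<integral>x. ?g (trunc J x) \<partial>\<nu>) = (\<Sum>w\<in>R. ?b w * ?g w)"
      unfolding R_def using integral_cylinder_function(1)[OF D(1,2) J, of ?g] by (simp add: mult.commute)
    then have "(\<integral>x. ?g (trunc J x) \<partial>\<nu>) - measure \<mu> (trunc J -` B \<inter> ?Y) = (\<Sum>w\<in>R. (?b w - ?a w) * ?g w)"
      unfolding snd[symmetric] by (simp add: sum_subtractf left_diff_distrib)
    also have "\<bar>\<dots>\<bar> \<le> (\<Sum>w\<in>R. d / card R)"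
    proof (rule order_trans[OF sum_abs], rule sum_mono)
      fix w assume w: "w \<in> R"
      have "\<bar>(?b w - ?a w) * ?g w\<bar> \<le> \<bar>?b w - ?a w\<bar> * 1"
        unfolding abs_mult by (rule mult_left_mono) auto
      then show "\<bar>(?b w - ?a w) * ?g w\<bar> \<le> d / card R" using a[OF w] unfolding mult_1_right abs_minus_commute[of "?b w"] by (rule order_trans)
    qed
    also have "\<dots> = d" using cR by simp
    finally show "\<bar>(\<integral>x. ?g (trunc J x) \<partial>\<nu>) - measure \<mu> (trunc J -` B \<inter> ?Y)\<bar> \<le> d" .
  qed
qed

section \<open>Random cutting\<close>

lemma sets_iid_coordinate: "{e. e i \<in> A} \<in> sets (iid Q)"
proof -
  have "(\<lambda>e. e i) -` A \<inter> space (iid Q) \<in> sets (iid Q)"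
    by (rule measurable_sets[of _ _ "measure_pmf Q"]) (simp_all add: iid_def)
  then show ?thesis by (simp add: vimage_def)
qed

lemma measure_iid_coordinates:
  assumes "finite I"
  shows "measure (iid Q) {e. \<forall>i\<in>I. e i \<in> A i} = (\<Prod>i\<in>I. measure_pmf.prob Q (A i))"
proof -
  interpret pr: product_prob_space "\<lambda>_::int. measure_pmf Q" UNIV by unfold_locales
  have "prod_emb UNIV (\<lambda>_. measure_pmf Q) I (Pi\<^sub>E I A) = {e. \<forall>i\<in>I. e i \<in> A i}"
    by (auto simp: prod_emb_def space_PiM PiE_UNIV_domain restrict_PiE_iff)
  then show ?thesis using pr.measure_PiM_emb[of I A] assms by (simp add: iid_def)
qed

definition block :: "nat \<Rightarrow> int set" where
  "block N = {0..<int N}"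

lemma finite_block [simp]: "finite (block N)"
  by (simp add: block_def)

text \<open>
  A mark \<open>Some u\<close> is a cut, \<open>None\<close> is no cut. The last cut at or before the origin is searched in the last \<open>N\<close>
  coordinates only, which makes the code one of finite range. Its random map \<open>u\<close> is applied to the block of \<open>x\<close>
  that begins at the cut, and the symbol of the image at the position of the origin is read.
\<close>

definition read_block :: "nat \<Rightarrow> (int \<Rightarrow> bool) \<Rightarrow> (int \<Rightarrow> ((int \<Rightarrow> bool) \<Rightarrow> (int \<Rightarrow> bool)) option) \<Rightarrow> bool" where
  "read_block N x e \<longleftrightarrow> (\<exists>k<N. (\<forall>l<k. e (- int l) = None) \<and>
     (\<exists>u. e (- int k) = Some u \<and> u (trunc (block N) (translate (- int k) x)) (int k)))"

definition cut_pmf :: "real \<Rightarrow> 'a pmf \<Rightarrow> 'a option pmf" where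
  "cut_pmf q U = bind_pmf (bernoulli_pmf q) (\<lambda>b. if b then map_pmf Some U else return_pmf None)"

lemma measure_cut_pmf:
  assumes "0 \<le> q" "q \<le> 1"
  shows "measure_pmf.prob (cut_pmf q U) A = q * measure_pmf.prob U (Some -` A) + (1 - q) * indicator A None"
  unfolding cut_pmf_def measure_bind_pmf
  using assms by (simp add: integral_bernoulli_pmf mult.commute)

lemma finite_range_code_read_block:
  assumes "subshift X" "uniquely_ergodic shift X" "\<nu> \<in> invariant_measures shift X"
  shows "finite_range_code X \<nu> Q (window N) (read_block N)"
proof
  show "read_block N x e = read_block N x' e'"
    if x: "\<And>i. i \<in> window N \<Longrightarrow> x i = x' i" and e: "\<And>i. i \<in> window N \<Longrightarrow> e i = e' i" for x x' e e'
  proof -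
    have "e (- int k) = e' (- int k)" if "k < N" for k using that by (intro e) (simp add: window_def)
    moreover have "trunc (block N) (translate (- int k) x) = trunc (block N) (translate (- int k) x')" if "k < N" for k
      unfolding trunc_eq_iff translate_def using that by (auto intro!: x simp: window_def block_def)
    ultimately show ?thesis
      unfolding read_block_def by (intro ex_cong1 conj_cong refl) auto
  qed
  show "{e. read_block N z e} \<in> sets (iid Q)" for z
  proof -
    have "{e. read_block N z e} = (\<Union>k<N. (\<Inter>l\<in>{..<k}. {e. e (- int l) \<in> {None}}) \<inter>
        {e. e (- int k) \<in> Some ` {u. u (trunc (block N) (translate (- int k) z)) (int k)}})"
      by (auto simp: read_block_def image_iff)
    also have "(\<Inter>l\<in>{..<k}. {e. e (- int l) \<in> {None}}) \<in> sets (iid Q)" for k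
    proof (cases "k = 0")
      case True
      then show ?thesis using sets.top[of "iid Q"] by simp
    next
      case False
      then show ?thesis by (intro sets.finite_INT sets_iid_coordinate) auto
    qed
    then have "(\<Union>k<N. (\<Inter>l\<in>{..<k}. {e. e (- int l) \<in> {None}}) \<inter>
        {e. e (- int k) \<in> Some ` {u. u (trunc (block N) (translate (- int k) z)) (int k)}}) \<in> sets (iid Q)"
      by (intro sets.finite_UN sets.Int sets_iid_coordinate) auto
    finally show ?thesis .
  qed
qed (use assms in auto)

text \<open>
  The event that the last cut up to coordinate \<open>L\<close> is at \<open>- k\<close>.
\<close>

definition cut_at :: "nat \<Rightarrow> nat \<Rightarrow> (int \<Rightarrow> 'a option) set" where
  "cut_at L k = {e. e (- int k) \<noteq> None \<and> (\<forall>i\<in>{- int k<..int L}. e i = None)}"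

lemma read_block_at_cut:
  assumes e: "e \<in> cut_at L k" and k: "L \<le> k" "k + L < N" and j: "j \<in> window L"
  shows "read_block N (translate j x) (translate j e) \<longleftrightarrow>
    the (e (- int k)) (trunc (block N) (translate (- int k) x)) (j + int k)"
proof -
  obtain u where u: "e (- int k) = Some u" using e by (auto simp: cut_at_def)
  define c where "c = nat (j + int k)"
  have c: "int c = j + int k" "c < N" using j k by (auto simp: c_def window_def)
  have before: "e (j - int l) = None" if "l < c" for l
    using e that c(1) j by (auto simp: cut_at_def window_def)
  have "read_block N (translate j x) (translate j e) \<longleftrightarrow>
      (\<exists>u. translate j e (- int c) = Some u \<and> u (trunc (block N) (translate (- int c) (translate j x))) (int c))"
  proof
    assume "read_block N (translate j x) (translate j e)"
    then obtain k' u' where k': "\<forall>l<k'. translate j e (- int l) = None" "translate j e (- int k') = Some u'"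
        "u' (trunc (block N) (translate (- int k') (translate j x))) (int k')"
      unfolding read_block_def by blast
    have "\<not> k' < c" using k'(2) before[of k'] by (auto simp: translate_def)
    moreover have "\<not> c < k'"
      using k'(1) u c(1) by (auto simp: translate_def dest!: spec[of _ c])
    ultimately have "k' = c" by simp
    then show "\<exists>u. translate j e (- int c) = Some u \<and> u (trunc (block N) (translate (- int c) (translate j x))) (int c)"
      using k' by blast
  next
    assume "\<exists>u. translate j e (- int c) = Some u \<and> u (trunc (block N) (translate (- int c) (translate j x))) (int c)"
    then show "read_block N (translate j x) (translate j e)"
      unfolding read_block_def using c(2) before by (intro exI[of _ c]) (auto simp: translate_def)
  qed
  also have "\<dots> \<longleftrightarrow> u (trunc (block N) (translate (- int k) x)) (j + int k)"
    using u c(1) by (simp add: translate_translate) (simp add: translate_def)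
  finally show ?thesis using u by simp
qed

lemma cut_at_eq_coordinates:
  "cut_at L k \<inter> {e. the (e (- int k)) \<in> S} =
    {e. \<forall>i\<in>insert (- int k) {- int k<..int L}. e i \<in> (if i = - int k then Some ` S else {None})}"
  by (auto simp: cut_at_def image_iff)

lemma sets_cut_at: "cut_at L k \<in> sets (iid Q)"
proof -
  have "cut_at L k = (\<Inter>i\<in>insert (- int k) {- int k<..int L}.
      {e. e i \<in> (if i = - int k then - {None} else {None})})"
    by (auto simp: cut_at_def)
  also have "\<dots> \<in> sets (iid Q)"
    by (intro sets.finite_INT sets_iid_coordinate) auto
  finally show ?thesis .
qed

lemma measure_cut_at:
  fixes U :: "'a pmf"
  assumes q: "0 \<le> q" "q \<le> 1" and k: "L \<le> k"
  shows "measure (iid (cut_pmf q U)) (cut_at L k \<inter> {e. the (e (- int k)) \<in> S}) =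
    q * (1 - q) ^ (k + L) * measure_pmf.prob U S"
proof -
  let ?A = "\<lambda>i. if i = - int k then Some ` S else {None}"
  have "measure (iid (cut_pmf q U)) (cut_at L k \<inter> {e. the (e (- int k)) \<in> S}) =
      (\<Prod>i\<in>insert (- int k) {- int k<..int L}. measure_pmf.prob (cut_pmf q U) (?A i))"
    unfolding cut_at_eq_coordinates by (rule measure_iid_coordinates) simp
  also have "\<dots> = measure_pmf.prob (cut_pmf q U) (Some ` S) *
      (\<Prod>i\<in>{- int k<..int L}. measure_pmf.prob (cut_pmf q U) {None})"
    by (subst prod.insert) auto
  also have "(\<Prod>i\<in>{- int k<..int L}. measure_pmf.prob (cut_pmf q U) {None}) = (1 - q) ^ (k + L)"
  proof -
    have "Some -` {None} = ({} :: 'a set)" by auto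
    then show ?thesis by (simp add: measure_cut_pmf[OF q] nat_add_distrib add.commute)
  qed
  also have "measure_pmf.prob (cut_pmf q U) (Some ` S) = q * measure_pmf.prob U S"
    by (simp add: measure_cut_pmf[OF q] inj_vimage_image_eq)
  finally show ?thesis by simp
qed

text \<open>
  The probability that there is a cut in \<open>{L - N<..- L}\<close> and none in \<open>{- L<..L}\<close>, decomposed by the place
  of the last cut.
\<close>

lemma sum_cut_probabilities:
  fixes q :: real
  assumes "2 * L \<le> N"
  shows "(\<Sum>k=L..<N-L. q * (1 - q) ^ (k + L)) = (1 - q) ^ (2 * L) - (1 - q) ^ N"
proof -
  have "(\<Sum>k=L..<N-L. q * (1 - q) ^ (k + L)) = (\<Sum>k=L..<N-L. (1 - q) ^ (k + L) - (1 - q) ^ (Suc k + L))"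
    by (rule sum.cong) (auto simp: algebra_simps)
  also have "\<dots> = - (\<Sum>k=L..<N-L. (1 - q) ^ (Suc k + L) - (1 - q) ^ (k + L))"
    by (simp add: sum_negf[symmetric] del: power_Suc)
  also have "\<dots> = (1 - q) ^ (L + L) - (1 - q) ^ (N - L + L)"
    using assms by (subst sum_Suc_diff') auto
  finally show ?thesis using assms by (simp add: mult_2)
qed

text \<open>
  First make cuts so rare that \<open>{- L<..L}\<close> is probably free of them, then make blocks so long that probably some
  cut is found before.
\<close>

lemma exists_cut_parameters:
  fixes d :: real
  assumes d: "d > 0"
  obtains q N where "0 < q" "q < 1" "2 * L \<le> N" "1 - ((1 - q) ^ (2 * L) - (1 - q) ^ N) < d"
proof -
  have "((\<lambda>q. (1 - q) ^ (2 * L)) \<longlongrightarrow> (1 - 0) ^ (2 * L)) (at_right (0::real))"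
    by (intro tendsto_intros)
  then have "\<forall>\<^sub>F q in at_right (0::real). 1 - d / 2 < (1 - q) ^ (2 * L)"
    using d by (intro order_tendstoD(1)) auto
  then have "\<forall>\<^sub>F q in at_right (0::real). 1 - d / 2 < (1 - q) ^ (2 * L) \<and> q \<in> {0<..<1}"
    by (intro eventually_conj eventually_at_right_real) auto
  then obtain q :: real where q: "1 - d / 2 < (1 - q) ^ (2 * L)" "0 < q" "q < 1"
    using eventually_happens[of _ "at_right (0::real)"] by auto
  have "(\<lambda>N. (1 - q) ^ N) \<longlonglongrightarrow> 0" by (rule LIMSEQ_realpow_zero) (use q in auto)
  then have "\<forall>\<^sub>F N in sequentially. (1 - q) ^ N < d / 2" using d by (intro order_tendstoD(2)) auto
  then have "\<forall>\<^sub>F N in sequentially. (1 - q) ^ N < d / 2 \<and> 2 * L \<le> N"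
    by (intro eventually_conj eventually_ge_at_top)
  then obtain N where "(1 - q) ^ N < d / 2" "2 * L \<le> N"
    unfolding eventually_sequentially by blast
  then show ?thesis using q by (intro that[of q N]) auto
qed

text \<open>
  On the event \<open>cut_at L k\<close> the window sees a block that starts at \<open>- k\<close>. The place of the cut is
  independent of \<open>x\<close>, so by invariance of \<open>\<nu>\<close> the block of \<open>x\<close> starting there has the law of a block at \<open>0\<close>, and by
  invariance of \<open>\<mu>\<close> the law of its random replacement on the window is nearly that of \<open>\<mu>\<close>, for every \<open>k\<close>.
  These events exhaust all but a fraction \<open>1 - s\<close>.
\<close>

lemma extreme_measure_window_close:
  assumes X: "subshift X" and ue: "uniquely_ergodic shift X" and \<nu>: "\<nu> \<in> invariant_measures shift X"
    and \<mu>: "\<mu> \<in> invariant_measures shift (hereditary_closure X)" and d: "d > 0"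
  shows "\<exists>\<mu>'\<in>extreme_measures (invariant_measures shift (hereditary_closure X)).
    window_close (hereditary_closure X) L d \<mu> \<mu>'"
proof -
  let ?Y = "hereditary_closure X"
  note DM = invariant_measuresD[OF \<mu>]
  have Y: "subshift ?Y" by (rule subshift_hereditary_closure[OF X])
  obtain q N where q: "0 < q" "q < 1" and N: "2 * L \<le> N"
    and s: "1 - ((1 - q) ^ (2 * L) - (1 - q) ^ N) < d / 4"
    by (rule exists_cut_parameters[of "d / 4" L]) (use d in auto)
  obtain G where G: "\<And>w v. v \<in> set_pmf (G w) \<Longrightarrow> v \<le> w"
    "\<And>B. \<bar>(\<integral>x. measure_pmf.prob (G (trunc (block N) x)) B \<partial>\<nu>) - measure \<mu> (trunc (block N) -` B \<inter> ?Y)\<bar> \<le> d / 4"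
    using block_kernel[OF X ue \<nu> \<mu> finite_block, of "d / 4"] d by auto
  define R where "R = range (trunc (block N))"
  have R: "finite R" unfolding R_def by (rule finite_range_trunc) simp
  \<comment> \<open>A mark draws the replacements of all words at once, so that it can be independent of \<open>x\<close>.\<close>
  define U where "U = Pi_pmf R (\<lambda>_. False) G"
  define Q where "Q = cut_pmf q U"
  interpret finite_range_code X \<nu> Q "window N" "read_block N"
    by (rule finite_range_code_read_block[OF X ue \<nu>])
  define p where "p k = q * (1 - q) ^ (k + L)" for k
  define s where "s = (\<Sum>k=L..<N-L. p k)"
  have s1: "1 - s < d / 4" using s unfolding s_def p_def sum_cut_probabilities[OF N] .
  have p0: "p k \<ge> 0" for k unfolding p_def using q by simp
  have s0: "s \<ge> 0" unfolding s_def by (intro sum_nonneg p0)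
  have sle: "s \<le> 1"
  proof -
    have "(1 - q) ^ (2 * L) \<le> 1" "0 \<le> (1 - q) ^ N" using q by (auto intro: power_le_one)
    then show ?thesis unfolding s_def p_def sum_cut_probabilities[OF N] by linarith
  qed
  have cut_prob: "measure (iid Q) (cut_at L k) = p k" if "L \<le> k" for k
    using measure_cut_at[of q L k U UNIV] q that by (simp add: Q_def p_def)
  have cut_disj: "disjoint_family_on (cut_at L) {L..<N-L}"
    unfolding disjoint_family_on_def
  proof (intro ballI impI)
    fix k k' assume "k \<in> {L..<N-L}" "k' \<in> {L..<N-L}" "k \<noteq> k'"
    then show "cut_at L k \<inter> cut_at L k' = {}"
      by (cases "k < k'") (auto simp: cut_at_def)
  qed
  have "window_close ?Y L d \<mu> code_measure"
    unfolding window_close_def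
  proof
    fix B
    define Bk where "Bk k = {v. trunc (window L) (translate (int k) v) \<in> B}" for k
    define g where "g k x = measure_pmf.prob (G (trunc (block N) (translate (- int k) x))) (Bk k)" for k x
    define T where "T x = {e. trunc (window L) (code x e) \<in> B}" for x
    define m where "m = measure \<mu> (trunc (window L) -` B \<inter> ?Y)"
    have T: "T x \<in> sets (iid Q)" for x unfolding T_def by (rule sets_code_section)
    have on_cut: "measure (iid Q) (T x \<inter> cut_at L k) = p k * g k x" if k: "k \<in> {L..<N-L}" for x k
    proof -
      let ?w = "trunc (block N) (translate (- int k) x)"
      let ?S = "{u. trunc (window L) (\<lambda>j. x j \<and> u ?w (j + int k)) \<in> B}"
      have "trunc (window L) (code x e) = trunc (window L) (\<lambda>j. x j \<and> the (e (- int k)) ?w (j + int k))"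
        if "e \<in> cut_at L k" for e
        using that k by (auto simp: trunc_eq_iff code_def read_block_at_cut)
      then have "T x \<inter> cut_at L k = cut_at L k \<inter> {e. the (e (- int k)) \<in> ?S}"
        by (auto simp: T_def)
      then have "measure (iid Q) (T x \<inter> cut_at L k) = p k * measure_pmf.prob U ?S"
        using measure_cut_at[of q L k U ?S] q k by (simp add: Q_def p_def)
      also have "measure_pmf.prob U ?S = measure_pmf.prob (map_pmf (\<lambda>u. u ?w) U)
          {v. trunc (window L) (\<lambda>j. x j \<and> v (j + int k)) \<in> B}"
        by (simp add: vimage_def)
      also have "map_pmf (\<lambda>u. u ?w) U = G ?w"
        unfolding U_def by (rule Pi_pmf_component[OF R, THEN trans]) (auto simp: R_def)
      also have "measure_pmf.prob (G ?w) {v. trunc (window L) (\<lambda>j. x j \<and> v (j + int k)) \<in> B} = g k x"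
        unfolding g_def
      proof (rule measure_pmf.finite_measure_eq_AE)
        show "AE v in measure_pmf (G ?w). (v \<in> {v. trunc (window L) (\<lambda>j. x j \<and> v (j + int k)) \<in> B}) = (v \<in> Bk k)"
          unfolding AE_measure_pmf_iff
        proof
          fix v assume "v \<in> set_pmf (G ?w)"
          then have "v \<le> ?w" by (rule G(1))
          then have "v (j + int k) \<Longrightarrow> x j" for j
            by (auto simp: le_fun_def trunc_def translate_def dest: spec[of _ "j + int k"])
          then have "(\<lambda>j. x j \<and> v (j + int k)) = translate (int k) v"
            by (auto simp: translate_def)
          then show "(v \<in> {v. trunc (window L) (\<lambda>j. x j \<and> v (j + int k)) \<in> B}) = (v \<in> Bk k)"
            by (simp add: Bk_def)
        qed
      qed simp_all
      finally show ?thesis .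
    qed
    have near_cut: "\<bar>measure (iid Q) (T x) - (\<Sum>k=L..<N-L. p k * g k x)\<bar> \<le> 1 - s" for x
    proof -
      let ?D = "\<Union>k\<in>{L..<N-L}. cut_at L k :: (int \<Rightarrow> ((int \<Rightarrow> bool) \<Rightarrow> int \<Rightarrow> bool) option) set"
      have D: "?D \<in> sets (iid Q)" using sets_cut_at by (intro sets.finite_UN) auto
      have "measure (iid Q) (T x) = measure (iid Q) (T x \<inter> ?D) + measure (iid Q) (T x - ?D)"
        using T[of x] D by (subst I.finite_measure_Union[symmetric]) (auto simp: Int_Diff_Un)
      moreover have "measure (iid Q) (T x \<inter> ?D) = (\<Sum>k=L..<N-L. p k * g k x)"
      proof -
        have "T x \<inter> ?D = (\<Union>k\<in>{L..<N-L}. T x \<inter> cut_at L k)" by auto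
        also have "measure (iid Q) \<dots> = (\<Sum>k=L..<N-L. measure (iid Q) (T x \<inter> cut_at L k))"
          using cut_disj T sets_cut_at
          by (intro I.finite_measure_finite_Union) (auto simp: disjoint_family_on_def intro!: sets.Int)
        also have "\<dots> = (\<Sum>k=L..<N-L. p k * g k x)" by (rule sum.cong) (auto simp: on_cut)
        finally show ?thesis .
      qed
      moreover have "measure (iid Q) (T x - ?D) \<le> 1 - s"
      proof -
        have "measure (iid Q) ?D = (\<Sum>k=L..<N-L. measure (iid Q) (cut_at L k))"
          using cut_disj sets_cut_at by (intro I.finite_measure_finite_Union) auto
        then have "measure (iid Q) ?D = s" by (simp add: s_def cut_prob)
        then have "measure (iid Q) (space (iid Q) - ?D) = 1 - s" using D I.prob_compl[of ?D] by simp
        moreover have "measure (iid Q) (T x - ?D) \<le> measure (iid Q) (space (iid Q) - ?D)"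
          by (intro I.finite_measure_mono sets.compl_sets D) auto
        ultimately show ?thesis by simp
      qed
      ultimately show ?thesis by simp
    qed
    have ig: "integrable \<nu> (g k)" for k
    proof -
      let ?K = "(\<lambda>i. i - int k) ` block N"
      have "trunc (block N) (translate (- int k) (trunc ?K x)) = trunc (block N) (translate (- int k) x)" for x
        by (auto simp: trunc_def translate_def fun_eq_iff)
      then show ?thesis
        unfolding g_def
        using integral_cylinder_function(2)[OF \<nu>D(1,2), of ?K
            "\<lambda>x. measure_pmf.prob (G (trunc (block N) (translate (- int k) x))) (Bk k)"] by simp
    qed
    have each: "\<bar>(\<integral>x. g k x \<partial>\<nu>) - m\<bar> \<le> d / 4" if k: "k \<in> {L..<N-L}" for k
    proof -
      have "(\<integral>x. g k x \<partial>\<nu>) = (\<integral>x. g k ((shift ^^ k) x) \<partial>\<nu>)"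
        using ig[of k] by (intro integral_shift_funpow[OF \<nu>, symmetric]) auto
      also have "\<dots> = (\<integral>x. measure_pmf.prob (G (trunc (block N) x)) (Bk k) \<partial>\<nu>)"
        by (simp add: g_def shift_funpow_translate translate_translate) (simp add: translate_def)
      finally have 1: "(\<integral>x. g k x \<partial>\<nu>) = (\<integral>x. measure_pmf.prob (G (trunc (block N) x)) (Bk k) \<partial>\<nu>)" .
      have "trunc (window L) (translate (int k) (trunc (block N) y)) = trunc (window L) ((shift ^^ k) y)" for y
        using k unfolding trunc_eq_iff shift_funpow_translate
        by (auto simp: translate_def trunc_def window_def block_def)
      then have "trunc (block N) -` Bk k \<inter> ?Y = (shift ^^ k) -` (trunc (window L) -` B \<inter> ?Y) \<inter> ?Y"
        by (auto simp: Bk_def subshift_funpow_iff[OF Y])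
      then have "measure \<mu> (trunc (block N) -` Bk k \<inter> ?Y) = m"
        unfolding m_def using measure_shift_funpow[OF \<mu>, of "trunc (window L) -` B \<inter> ?Y" k]
          sets_borel_restrictD(4)[OF DM(2), of "window L" B] by simp
      then show ?thesis using G(2)[of "Bk k"] 1 by simp
    qed
    have "\<bar>measure code_measure (trunc (window L) -` B \<inter> ?Y) - (\<Sum>k=L..<N-L. p k * (\<integral>x. g k x \<partial>\<nu>))\<bar> \<le> 1 - s"
    proof -
      have iT: "integrable \<nu> (\<lambda>x. measure (iid Q) (T x))" unfolding T_def by (rule integrable_code_section)
      have iS: "integrable \<nu> (\<lambda>x. \<Sum>k=L..<N-L. p k * g k x)" using ig by simp
      have "(\<Sum>k=L..<N-L. p k * (\<integral>x. g k x \<partial>\<nu>)) = (\<integral>x. (\<Sum>k=L..<N-L. p k * g k x) \<partial>\<nu>)"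
        using ig by simp
      then have "measure code_measure (trunc (window L) -` B \<inter> ?Y) - (\<Sum>k=L..<N-L. p k * (\<integral>x. g k x \<partial>\<nu>)) =
          (\<integral>x. measure (iid Q) (T x) - (\<Sum>k=L..<N-L. p k * g k x) \<partial>\<nu>)"
        unfolding measure_code_measure using iT iS by (simp add: T_def)
      also have "\<bar>\<dots>\<bar> \<le> (\<integral>x. \<bar>measure (iid Q) (T x) - (\<Sum>k=L..<N-L. p k * g k x)\<bar> \<partial>\<nu>)"
        by (rule integral_abs_bound)
      also have "\<dots> \<le> 1 - s"
        using iT iS near_cut by (intro N.integral_le_const integrable_abs Bochner_Integration.integrable_diff) auto
      finally show ?thesis .
    qed
    moreover have "\<bar>(\<Sum>k=L..<N-L. p k * (\<integral>x. g k x \<partial>\<nu>)) - s * m\<bar> \<le> d / 4"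
    proof -
      have "(\<Sum>k=L..<N-L. p k * (\<integral>x. g k x \<partial>\<nu>)) - s * m = (\<Sum>k=L..<N-L. p k * ((\<integral>x. g k x \<partial>\<nu>) - m))"
        by (simp add: s_def sum_distrib_right sum_subtractf right_diff_distrib)
      also have "\<bar>\<dots>\<bar> \<le> (\<Sum>k=L..<N-L. p k * (d / 4))"
      proof (rule order_trans[OF sum_abs], rule sum_mono)
        fix k assume "k \<in> {L..<N-L}"
        from mult_left_mono[OF each[OF this] p0]
        show "\<bar>p k * ((\<integral>x. g k x \<partial>\<nu>) - m)\<bar> \<le> p k * (d / 4)"
          unfolding abs_mult abs_of_nonneg[OF p0] .
      qed
      also have "\<dots> = s * (d / 4)" by (simp only: s_def sum_distrib_right)
      also have "\<dots> \<le> 1 * (d / 4)" using sle d by (intro mult_right_mono) auto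
      finally show ?thesis by simp
    qed
    moreover have "\<bar>s * m - m\<bar> \<le> 1 - s"
    proof -
      have m: "0 \<le> m" "m \<le> 1" unfolding m_def using DM(1) by (auto intro: prob_space.prob_le_1)
      have "s * m - m = - ((1 - s) * m)" by (simp add: algebra_simps)
      moreover have "0 \<le> (1 - s) * m" using sle m by simp
      ultimately have "\<bar>s * m - m\<bar> = (1 - s) * m" by linarith
      also have "\<dots> \<le> (1 - s) * 1" using sle m by (intro mult_left_mono) auto
      finally show ?thesis by simp
    qed
    ultimately show "\<bar>measure code_measure (trunc (window L) -` B \<inter> ?Y) - measure \<mu> (trunc (window L) -` B \<inter> ?Y)\<bar> < d"
      using s1 d unfolding m_def[symmetric] by linarith
  qed
  then show ?thesis using code_measure_extreme by blast
qed

section \<open>Non-triviality\<close>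

lemma sum_Pow_power_card:
  fixes t :: "'a::comm_semiring_1"
  assumes "finite K" shows "(\<Sum>A\<in>Pow K. t ^ card A) = (1 + t) ^ card K"
  using prod_add[OF assms, of "\<lambda>_. t" "\<lambda>_. 1"] by (simp add: add.commute)

text \<open>
  A Chernoff bound: weight each word by \<open>t\<close> to the number of its ones. The total weight of all words is
  \<open>(1 + t) ^ card K\<close>, and each sparse word has weight at least \<open>t powr a\<close>.
\<close>

lemma sparse_words_card_bound:
  fixes t a :: real
  assumes K: "finite K" and t: "0 < t" "t \<le> 1" and W: "W \<subseteq> range (trunc K)"
    and sparse: "\<And>w. w \<in> W \<Longrightarrow> real (card {i \<in> K. w i}) \<le> a"
  shows "real (card W) * t powr a \<le> (1 + t) ^ card K"
proof -
  let ?f = "\<lambda>w. {i \<in> K. w i}"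
  have fW: "finite W" using W finite_range_trunc[OF K] by (rule finite_subset)
  have inj: "inj_on ?f W"
  proof (rule inj_onI)
    fix v w assume "v \<in> W" "w \<in> W" and eq: "?f v = ?f w"
    then obtain x y where xy: "v = trunc K x" "w = trunc K y" using W by blast
    have "v i = w i" for i using eq unfolding xy trunc_def by blast
    then show "v = w" by blast
  qed
  have "real (card W) * t powr a = (\<Sum>w\<in>W. t powr a)" by simp
  also have "\<dots> \<le> (\<Sum>w\<in>W. t ^ card (?f w))"
  proof (rule sum_mono)
    fix w assume "w \<in> W"
    then have "t powr a \<le> t powr real (card (?f w))" using sparse t by (intro powr_mono') auto
    then show "t powr a \<le> t ^ card (?f w)" using t by (simp add: powr_realpow)
  qed
  also have "\<dots> = (\<Sum>A\<in>?f ` W. t ^ card A)" by (simp add: sum.reindex[OF inj])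
  also have "\<dots> \<le> (\<Sum>A\<in>Pow K. t ^ card A)"
    using K t by (intro sum_mono2) auto
  also have "\<dots> = (1 + t) ^ card K" by (rule sum_Pow_power_card[OF K])
  finally show ?thesis .
qed

lemma min_subcover_card_le:
  assumes "finite \<V>" "\<V> \<subseteq> \<U>" "Y \<subseteq> \<Union>\<V>" shows "min_subcover_card Y \<U> \<le> card \<V>"
  unfolding min_subcover_card_def using assms by (intro cInf_lower) auto

text \<open>
  By the Lebesgue number lemma an element of the cover containing a point can be chosen from its word on one
  window, so an element of the join can be chosen from the word on an interval longer by a constant.
\<close>

lemma min_subcover_card_le_words:
  assumes Y: "subshift Y" and U: "\<U> \<in> open_covers Y"
  shows "\<exists>m. \<forall>n. min_subcover_card Y (cover_join shift Y \<U> n) \<le>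
    card (trunc {- int m..<int n + int m} ` Y)"
proof -
  have fine: "\<exists>V. open V \<and> x \<in> V \<and> (\<exists>U\<in>\<U>. V \<inter> Y \<subseteq> U)" if "x \<in> Y" for x
  proof -
    have "x \<in> \<Union>\<U>" using U that by (simp add: open_covers_def)
    then obtain U where "U \<in> \<U>" "x \<in> U" by blast
    moreover have "openin (top_of_set Y) U" using U \<open>U \<in> \<U>\<close> by (simp add: open_covers_def)
    then obtain V where "open V" "U = Y \<inter> V" by (auto simp: openin_open)
    ultimately show ?thesis by blast
  qed
  obtain m where m: "\<And>x. x \<in> Y \<Longrightarrow> \<exists>U\<in>\<U>. trunc (window m) -` {trunc (window m) x} \<inter> Y \<subseteq> U"
  proof (rule uniform_window[OF subshift_closed[OF Y], where P = "\<lambda>A. \<exists>U\<in>\<U>. A \<subseteq> U"])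
    show "\<exists>V. open V \<and> x \<in> V \<and> (\<exists>U\<in>\<U>. V \<inter> Y \<subseteq> U)" if "x \<in> Y" for x by (rule fine[OF that])
    show "\<exists>U\<in>\<U>. B \<subseteq> U" if "\<exists>U\<in>\<U>. A \<subseteq> U" "B \<subseteq> A" for A B using that by (meson order_trans)
  qed (rule that, auto)
  define V where "V z = (SOME U. U \<in> \<U> \<and> trunc (window m) -` {z} \<inter> Y \<subseteq> U)" for z
  have V: "V (trunc (window m) x) \<in> \<U>" "x \<in> V (trunc (window m) x)" if "x \<in> Y" for x
  proof -
    have "\<exists>U. U \<in> \<U> \<and> trunc (window m) -` {trunc (window m) x} \<inter> Y \<subseteq> U" using m[OF that] by blast
    then have "V (trunc (window m) x) \<in> \<U> \<and> trunc (window m) -` {trunc (window m) x} \<inter> Y \<subseteq> V (trunc (window m) x)"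
      unfolding V_def by (rule someI_ex)
    then show "V (trunc (window m) x) \<in> \<U>" "x \<in> V (trunc (window m) x)" using that by auto
  qed
  show ?thesis
  proof (intro exI[of _ m] allI)
    fix n
    let ?K = "{- int m..<int n + int m}"
    define E where "E w = {x \<in> Y. \<forall>i<n. (shift ^^ i) x \<in> V (trunc (window m) ((shift ^^ i) w))}" for w
    have sub: "trunc (window m) ((shift ^^ i) (trunc ?K y)) = trunc (window m) ((shift ^^ i) y)" if "i < n" for i y
      using that unfolding trunc_eq_iff by (auto simp: shift_funpow trunc_def window_def)
    have "min_subcover_card Y (cover_join shift Y \<U> n) \<le> card (E ` trunc ?K ` Y)"
    proof (rule min_subcover_card_le)
      have "finite (trunc ?K ` Y)"
        by (rule finite_subset[OF _ finite_range_trunc[of ?K]]) auto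
      then show "finite (E ` trunc ?K ` Y)" by simp
      show "E ` trunc ?K ` Y \<subseteq> cover_join shift Y \<U> n"
      proof
        fix A assume "A \<in> E ` trunc ?K ` Y"
        then obtain y where y: "y \<in> Y" "A = E (trunc ?K y)" by blast
        let ?V = "\<lambda>i. V (trunc (window m) ((shift ^^ i) (trunc ?K y)))"
        have "\<forall>i<n. ?V i \<in> \<U>" using y(1) V(1) by (simp add: sub subshift_funpow_iff[OF Y])
        then show "A \<in> cover_join shift Y \<U> n"
          unfolding cover_join_def y(2) E_def mem_Collect_eq by (intro exI[of _ ?V] conjI refl)
      qed
      show "Y \<subseteq> \<Union> (E ` trunc ?K ` Y)"
      proof
        fix y assume y: "y \<in> Y"
        then have "y \<in> E (trunc ?K y)"
          unfolding E_def using V(2) by (simp add: sub subshift_funpow_iff[OF Y])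
        then show "y \<in> \<Union> (E ` trunc ?K ` Y)" using y by blast
      qed
    qed
    also have "\<dots> \<le> card (trunc ?K ` Y)"
      by (rule card_image_le) (rule finite_subset[OF _ finite_range_trunc[of ?K]], auto)
    finally show "min_subcover_card Y (cover_join shift Y \<U> n) \<le> card (trunc ?K ` Y)" .
  qed
qed

text \<open>
  A point of the hereditary closure has at most as many ones as the point of \<open>X\<close> above it, and the latter are
  uniformly sparse, so the word-counting bound applies to the words of the hereditary closure.
\<close>

lemma zero_density_imp_zero_entropy:
  assumes X: "subshift X" and ue: "uniquely_ergodic shift X" and \<nu>: "\<nu> \<in> invariant_measures shift X"
    and zero: "measure \<nu> ({x. x 0} \<inter> X) = 0"
  shows "topological_entropy shift (hereditary_closure X) \<le> 0"
proof -
  let ?Y = "hereditary_closure X"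
  have Y: "subshift ?Y" by (rule subshift_hereditary_closure[OF X])
  have cyl: "{x. x 0} \<in> cylinders"
  proof -
    have "{x. x 0} = trunc (window 0) -` {z. z 0}" by (auto simp: trunc_def window_def)
    then show ?thesis unfolding cylinders_def by blast
  qed
  have "cover_entropy shift ?Y \<U> \<le> ereal e" if U: "\<U> \<in> open_covers ?Y" and e: "e > 0" for \<U> e
  proof -
    obtain m where m: "\<And>n. min_subcover_card ?Y (cover_join shift ?Y \<U> n) \<le>
        card (trunc {- int m..<int n + int m} ` ?Y)"
      using min_subcover_card_le_words[OF Y U] by blast
    \<comment> \<open>With these choices both \<open>ln (1 + t)\<close> and \<open>- \<delta> * ln t\<close> are at most \<open>e / 4\<close>.\<close>
    define t where "t = min (1 / 2) (e / 4)"
    have t: "0 < t" "t < 1" "t \<le> e / 4" using e by (auto simp: t_def)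
    have lt: "ln t < 0" using t by simp
    define \<delta> where "\<delta> = e / 4 / (- ln t)"
    have \<delta>: "\<delta> > 0" unfolding \<delta>_def using e lt by (intro divide_pos_pos) auto
    have "\<forall>\<^sub>F M in sequentially. \<forall>x\<in>X. frequency M x {x. x 0} < \<delta>"
      using uniform_upper_frequency[OF X ue \<nu> cyl \<delta>] by (simp add: zero)
    then obtain M0 where M0: "\<And>M x. M \<ge> M0 \<Longrightarrow> x \<in> X \<Longrightarrow> frequency M x {x. x 0} < \<delta>"
      unfolding eventually_sequentially by blast
    have bound: "ln (real (min_subcover_card ?Y (cover_join shift ?Y \<U> n))) / real n \<le> e"
      if n: "n \<ge> M0" "n \<ge> 2 * m" "n > 0" for n
    proof -
      define M where "M = n + 2 * m"
      let ?K = "{- int m..<int n + int m}"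
      let ?W = "trunc ?K ` ?Y"
      have cK: "card ?K = M" by (simp add: M_def)
      have W: "finite ?W" by (rule finite_subset[OF _ finite_range_trunc[of ?K]]) auto
      have "real (card ?W) * t powr (\<delta> * M) \<le> (1 + t) ^ card ?K"
      proof (rule sparse_words_card_bound)
        fix w assume "w \<in> ?W"
        then obtain y x where w: "w = trunc ?K y" and yx: "y \<le> x" "x \<in> X"
          unfolding hereditary_closure_def by blast
        define x' where "x' = translate (- int m) x"
        have "(shift ^^ m) x' = x" by (simp add: x'_def shift_funpow_translate translate_translate) (simp add: translate_def)
        then have x': "x' \<in> X" using yx(2) subshift_funpow_iff[OF X, of m x'] by simp
        have "card {i \<in> ?K. w i} \<le> card {i \<in> {..<M}. x' (int i)}"
        proof (rule card_inj_on_le[where f = "\<lambda>i. nat (i + int m)"])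
          show "inj_on (\<lambda>i. nat (i + int m)) {i \<in> ?K. w i}" by (auto simp: inj_on_def)
          show "(\<lambda>i. nat (i + int m)) ` {i \<in> ?K. w i} \<subseteq> {i \<in> {..<M}. x' (int i)}"
            using yx(1) by (auto simp: w trunc_def x'_def translate_def le_fun_def M_def)
        qed simp
        also have "real (card {i \<in> {..<M}. x' (int i)}) = (\<Sum>i<M. indicator {x. x 0} ((shift ^^ i) x'))"
          by (simp add: indicator_def sum.If_cases Int_def shift_funpow)
        also have "\<dots> = frequency M x' {x. x 0} * real M"
          using n(3) by (simp add: frequency_def M_def)
        also have "\<dots> \<le> \<delta> * real M"
          using M0[OF _ x', of M] n(1) by (intro mult_right_mono) (auto simp: M_def)
        finally show "real (card {i \<in> ?K. w i}) \<le> \<delta> * real M" by simp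
      qed (use t in auto)
      then have "real (card ?W) * t powr (\<delta> * M) \<le> (1 + t) ^ M" by (simp only: cK)
      moreover have cW: "card ?W > 0" using W Y by (auto simp: card_gt_0_iff subshift_def)
      ultimately have "ln (real (card ?W) * t powr (\<delta> * M)) \<le> ln ((1 + t) ^ M)"
        using t by (intro ln_mono) auto
      then have "ln (real (card ?W)) + \<delta> * M * ln t \<le> M * ln (1 + t)"
        using cW t by (simp add: ln_mult ln_powr ln_realpow)
      moreover have "\<delta> * M * ln t = - (M * (e / 4))" using lt by (simp add: \<delta>_def)
      moreover have "M * ln (1 + t) \<le> M * (e / 4)"
        using ln_add_one_self_le_self[of t] t by (intro mult_left_mono) auto
      ultimately have "ln (real (card ?W)) \<le> M * (e / 2)" by (simp add: field_simps)
      also have "\<dots> \<le> (2 * n) * (e / 2)" using n(2) e by (intro mult_right_mono) (auto simp: M_def)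
      finally have ln_W: "ln (real (card ?W)) \<le> n * e" by simp
      have "ln (real (min_subcover_card ?Y (cover_join shift ?Y \<U> n))) \<le> n * e"
      proof (cases "min_subcover_card ?Y (cover_join shift ?Y \<U> n) = 0")
        \<comment> \<open>Here \<open>ln 0 = 0\<close>.\<close>
        case True
        then show ?thesis using e by simp
      next
        case False
        then have "ln (real (min_subcover_card ?Y (cover_join shift ?Y \<U> n))) \<le> ln (real (card ?W))"
          using m[of n] by (intro ln_mono) auto
        then show ?thesis using ln_W by simp
      qed
      then show ?thesis using n(3) by (simp add: divide_le_eq mult.commute)
    qed
    show ?thesis
      unfolding cover_entropy_def
      by (rule Limsup_bounded, rule eventually_sequentiallyI[of "max M0 (max (2 * m) 1)"]) (use bound in auto)
  qed
  then have "topological_entropy shift ?Y \<le> ereal e" if "e > 0" for e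
    unfolding topological_entropy_def using that by (intro SUP_least) auto
  then have "\<And>e. e > 0 \<Longrightarrow> topological_entropy shift ?Y \<le> 0 + ereal e" by simp
  then show ?thesis by (rule ereal_le_epsilon2)
qed

text \<open>
  The code with \<open>\<phi>\<close> constantly false yields the point mass at the zero configuration, and the one with \<open>\<phi>\<close>
  constantly true yields \<open>\<nu>\<close> itself, regarded as a measure on the hereditary closure.
\<close>

lemma exists_distinct_invariant_measures:
  assumes X: "subshift X" and ue: "uniquely_ergodic shift X" and \<nu>: "\<nu> \<in> invariant_measures shift X"
    and pos: "measure \<nu> ({x. x 0} \<inter> X) \<noteq> 0"
  shows "\<exists>\<mu>\<in>invariant_measures shift (hereditary_closure X).
    \<exists>\<mu>'\<in>invariant_measures shift (hereditary_closure X). \<mu> \<noteq> \<mu>'"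
proof -
  have UN: "UNIV \<in> sets (iid (return_pmf ()))" using sets.top[of "iid (return_pmf ())"] by simp
  interpret zero: finite_range_code X \<nu> "return_pmf ()" "{}" "\<lambda>_ _. False"
    by standard (use X ue \<nu> in auto)
  interpret one: finite_range_code X \<nu> "return_pmf ()" "{}" "\<lambda>_ _. True"
    by standard (use X ue \<nu> UN in auto)
  let ?A = "trunc (window 0) -` {z. z 0} \<inter> hereditary_closure X"
  have "measure zero.code_measure ?A = 0"
    unfolding zero.measure_code_measure zero.code_def by (simp add: trunc_def)
  moreover have "measure one.code_measure ?A = measure \<nu> ({x. x 0} \<inter> X)"
  proof -
    have "measure (iid (return_pmf ())) {e. trunc (window 0) (one.code x e) \<in> {z. z 0}} =
        indicator ({x. x 0} \<inter> X) x" if "x \<in> space \<nu>" for x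
      using that one.\<nu>D(5) by (auto simp: one.code_def trunc_def window_def indicator_def)
    then have "measure one.code_measure ?A = (\<integral>x. indicator ({x. x 0} \<inter> X) x \<partial>\<nu>)"
      unfolding one.measure_code_measure by (intro Bochner_Integration.integral_cong) auto
    then show ?thesis using one.\<nu>D(5) by simp
  qed
  ultimately have "zero.code_measure \<noteq> one.code_measure" using pos by auto
  then show ?thesis using zero.code_measure_invariant one.code_measure_invariant by blast
qed

section \<open>The Poulsen property\<close>

theorem corollary1:
  fixes X :: "(int \<Rightarrow> bool) set"
  assumes "subshift X"
    and "uniquely_ergodic shift X"
    and "topological_entropy shift (hereditary_closure X) > 0"
  shows "poulsen (weak_topology shift (hereditary_closure X))"
proof -
  let ?Y = "hereditary_closure X"
  obtain \<nu> where \<nu>: "\<nu> \<in> invariant_measures shift X"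
    using assms(2) unfolding uniquely_ergodic_def by blast
  have "measure \<nu> ({x. x 0} \<inter> X) \<noteq> 0"
    using zero_density_imp_zero_entropy[OF assms(1,2) \<nu>] assms(3) by auto
  then have "\<exists>\<mu>\<in>invariant_measures shift ?Y. \<exists>\<mu>'\<in>invariant_measures shift ?Y. \<mu> \<noteq> \<mu>'"
    by (rule exists_distinct_invariant_measures[OF assms(1,2) \<nu>])
  moreover have "weak_topology shift ?Y closure_of extreme_measures (invariant_measures shift ?Y) =
      invariant_measures shift ?Y"
  proof (rule weak_closure_eqI)
    show "closed ?Y" by (rule subshift_closed[OF subshift_hereditary_closure[OF assms(1)]])
    show "hereditary ?Y" by (rule hereditary_hereditary_closure)
    show "extreme_measures (invariant_measures shift ?Y) \<subseteq> invariant_measures shift ?Y"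
      by (auto simp: extreme_measures_def)
    show "\<exists>\<nu>\<in>extreme_measures (invariant_measures shift ?Y). window_close ?Y n d \<mu> \<nu>"
      if "\<mu> \<in> invariant_measures shift ?Y" "d > 0" for \<mu> n d
      by (rule extreme_measure_window_close[OF assms(1,2) \<nu> that])
  qed
  ultimately show ?thesis unfolding poulsen_def topspace_weak_topology by blast
qed

end
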